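(* Let $X$ be a Tychonoff space. Then the following assertions are equivalent: (a) $C_p(X,\mathbb{R})$ is Baire; (b) $C_p(X,M)$ is Baire for some Fréchet space $M$ with $\dim M>0$; (c) $C_p(X,L)$ is Baire for any Fréchet space $L$.
   Context: For spaces $X,Y$, $C_p(X,Y)$ denotes the set of all continuous functions from $X$ to $Y$ with the topology of pointwise convergence (i.e. the subspace topology from the product $Y^X$). A topological space is Baire if the intersection of any sequence of its open dense subsets is dense in it. A topological vector space is a Fréchet space if it is a locally convex complete metrizable space. *)

theory Defs
  imports
    "HOL-Analysis.Analysis"
    "HOL-Algebra.Module"
    "HOL-Algebra.Algebraic_Closure_Type"
    "HOL-Library.Equipollence"
begin

(* HOL-Algebra reserves the bare identifier X for polynomial variables. *)
no_notation var (\<open>X\<index>\<close>)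

definition Baire_space :: "'a topology \<Rightarrow> bool"
  where "Baire_space T \<longleftrightarrow>
    (\<forall>U :: nat \<Rightarrow> 'a set.
       (\<forall>n. openin T (U n) \<and> T closure_of U n = topspace T)
       \<longrightarrow> T closure_of (\<Inter>n. U n) = topspace T)"

text \<open>
  The points of \<^const>\<open>product_topology\<close> are extensional functions, so each continuous map
  is represented exactly once, by the function that is \<^const>\<open>undefined\<close> off the space.
\<close>
definition Cp :: "'a topology \<Rightarrow> 'b topology \<Rightarrow> ('a \<Rightarrow> 'b) topology"
  where "Cp X Y = subtopology (product_topology (\<lambda>_. Y) (topspace X)) {f. continuous_map X Y f}"

text \<open>
  A real vector space is a module over the field of reals. Only the additive structure, the
  carrier and the scalar multiplication of the record are used; its ring multiplication and
  ring unit are irrelevant.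
\<close>
abbreviation real_field :: "real ring"
  where "real_field \<equiv> ring_of_type_algebra"

definition real_tvs :: "(real, 'v) module \<Rightarrow> 'v topology \<Rightarrow> bool"
  where "real_tvs V T \<longleftrightarrow>
    Module.module real_field V \<and>
    topspace T = carrier V \<and>
    continuous_map (prod_topology T T) T (\<lambda>(x, y). x \<oplus>\<^bsub>V\<^esub> y) \<and>
    continuous_map (prod_topology euclideanreal T) T (\<lambda>(r, x). r \<odot>\<^bsub>V\<^esub> x)"

definition convex_in :: "(real, 'v) module \<Rightarrow> 'v set \<Rightarrow> bool"
  where "convex_in V S \<longleftrightarrow>
    (\<forall>x\<in>S. \<forall>y\<in>S. \<forall>t\<in>{0..1}. ((1 - t) \<odot>\<^bsub>V\<^esub> x) \<oplus>\<^bsub>V\<^esub> (t \<odot>\<^bsub>V\<^esub> y) \<in> S)"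

definition locally_convex :: "(real, 'v) module \<Rightarrow> 'v topology \<Rightarrow> bool"
  where "locally_convex V T \<longleftrightarrow> neighbourhood_base_at \<zero>\<^bsub>V\<^esub> (convex_in V) T"

definition tvs_cauchy_filter :: "(real, 'v) module \<Rightarrow> 'v topology \<Rightarrow> 'v filter \<Rightarrow> bool"
  where "tvs_cauchy_filter V T F \<longleftrightarrow>
    F \<noteq> bot \<and> (\<forall>\<^sub>F x in F. x \<in> carrier V) \<and>
    (\<forall>U. openin T U \<and> \<zero>\<^bsub>V\<^esub> \<in> U \<longrightarrow>
      (\<exists>A \<subseteq> carrier V. (\<forall>\<^sub>F x in F. x \<in> A) \<and> (\<forall>x\<in>A. \<forall>y\<in>A. x \<ominus>\<^bsub>V\<^esub> y \<in> U)))"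

text \<open>Completeness with respect to the canonical (translation) uniformity.\<close>
definition tvs_complete :: "(real, 'v) module \<Rightarrow> 'v topology \<Rightarrow> bool"
  where "tvs_complete V T \<longleftrightarrow>
    (\<forall>F. tvs_cauchy_filter V T F \<longrightarrow> (\<exists>l. limitin T (\<lambda>x. x) l F))"

definition frechet_space :: "(real, 'v) module \<Rightarrow> 'v topology \<Rightarrow> bool"
  where "frechet_space V T \<longleftrightarrow>
    real_tvs V T \<and> locally_convex V T \<and> tvs_complete V T \<and> metrizable_space T"

text \<open>Hamel basis: every vector has a unique expansion with finitely many nonzero coefficients.\<close>
definition hamel_basis :: "(real, 'v) module \<Rightarrow> 'v set \<Rightarrow> bool"
  where "hamel_basis V B \<longleftrightarrow>
    B \<subseteq> carrier V \<and>
    (\<forall>x \<in> carrier V. \<exists>!c :: 'v \<Rightarrow> real.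
       finite {b. c b \<noteq> 0} \<and> {b. c b \<noteq> 0} \<subseteq> B \<and>
       x = finsum V (\<lambda>b. c b \<odot>\<^bsub>V\<^esub> b) {b. c b \<noteq> 0})"

text \<open>The dimension is the cardinality of a basis; it is positive iff a basis is nonempty.\<close>
definition positive_dim :: "(real, 'v) module \<Rightarrow> bool"
  where "positive_dim V \<longleftrightarrow> (\<exists>B. hamel_basis V B \<and> B \<noteq> {})"

end

theory Submission
  imports Defs
begin

text \<open>
  From \<open>\<real>\<close> to a Frechet space \<open>L\<close>: the maps \<open>\<gamma> \<circ> f\<close> with \<open>f \<in> C(X, \<real>)\<close> and a path \<open>\<gamma> : \<real> \<rightarrow> L\<close>
  suffice. If \<open>U\<close> is open and dense in \<open>C\<^sub>p(X, L)\<close>, then a given pair \<open>(f, \<gamma>)\<close> can be moved into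
  \<open>U\<close> by changing \<open>f\<close> little on a prescribed finite set and \<open>\<gamma>\<close> little on a prescribed interval: make
  \<open>f\<close> injective on the finitely many points that matter, send the new ones outside the interval, and
  correct \<open>\<gamma>\<close> there. So \<open>U\<close> pulls back to a dense open set of \<open>C\<^sub>p(X, \<real>) \<times> C(\<real>, L)\<close>, the product
  of a Baire space and a complete metric space, which is Baire.

  From a Frechet space \<open>M\<close> with a vector \<open>e \<noteq> 0\<close> to \<open>\<real>\<close>: a continuous \<open>r : M \<rightarrow> \<real>\<close> with
  \<open>r (x + u e) = r x + u\<close> makes \<open>f \<mapsto> r \<circ> f\<close> a continuous open surjection, since through each \<open>f\<close>
  passes the continuous section \<open>g \<mapsto> f + (g - r \<circ> f) e\<close>.
\<close>

subsection \<open>Baire spaces\<close>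

lemma Baire_space_alt:
  "Baire_space T \<longleftrightarrow>
    (\<forall>U :: nat \<Rightarrow> 'a set. (\<forall>n. openin T (U n) \<and> T closure_of U n = topspace T) \<longrightarrow>
      (\<forall>W. openin T W \<longrightarrow> W \<noteq> {} \<longrightarrow> (\<exists>x\<in>W. \<forall>n. x \<in> U n)))"
proof -
  have "T closure_of (\<Inter>n. U n) = topspace T \<longleftrightarrow>
      (\<forall>W. openin T W \<longrightarrow> W \<noteq> {} \<longrightarrow> (\<exists>x\<in>W. \<forall>n. x \<in> U n))" for U :: "nat \<Rightarrow> 'a set"
  proof -
    have "(\<Inter>n. U n) \<inter> W \<noteq> {} \<longleftrightarrow> (\<exists>x\<in>W. \<forall>n. x \<in> U n)" for W
      by auto
    then show ?thesis
      by (simp add: dense_intersects_open imp_conjL)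
  qed
  then show ?thesis
    by (simp add: Baire_space_def)
qed

text \<open>Openness of \<open>\<phi>\<close> makes preimages of dense sets dense: the image of a
  nonempty open \<open>V\<close> is open and nonempty, so it meets \<open>U n\<close>. A point found
  in \<open>A\<close> is then mapped to \<open>B\<close>.\<close>

lemma Baire_space_open_surjection:
  assumes "Baire_space A" and cont: "continuous_map A B \<phi>" and "open_map A B \<phi>"
    and surj: "\<phi> ` topspace A = topspace B"
  shows "Baire_space B"
  unfolding Baire_space_alt
proof (intro allI impI)
  fix U :: "nat \<Rightarrow> 'b set" and W
  assume U: "\<forall>n. openin B (U n) \<and> B closure_of U n = topspace B"
    and W: "openin B W" "W \<noteq> {}"
  define pre where "pre S = {x \<in> topspace A. \<phi> x \<in> S}" for S
  have pre_open: "openin A (pre S)" if "openin B S" for S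
    unfolding pre_def using cont that by (rule openin_continuous_map_preimage)
  have "A closure_of pre (U n) = topspace A" for n
    unfolding dense_intersects_open
  proof (intro allI impI)
    fix V assume V: "openin A V \<and> V \<noteq> {}"
    then have "openin B (\<phi> ` V)" "\<phi> ` V \<noteq> {}"
      using assms(3) by (auto simp: open_map_def)
    then obtain y where "y \<in> U n" "y \<in> \<phi> ` V"
      using U unfolding dense_intersects_open by blast
    then show "pre (U n) \<inter> V \<noteq> {}"
      using openin_subset V by (fastforce simp: pre_def)
  qed
  moreover have "pre W \<noteq> {}"
    proof -
    obtain y where y: "y \<in> W" "y \<in> topspace B"
      using W openin_subset by blast
    then obtain x where "x \<in> topspace A" "\<phi> x = y"
      using surj by (metis imageE)
    then show ?thesis
      using y by (auto simp: pre_def)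
  qed
  ultimately obtain x where "x \<in> pre W" "\<forall>n. x \<in> pre (U n)"
    using assms(1)[unfolded Baire_space_alt, rule_format, of "\<lambda>n. pre (U n)" "pre W"] pre_open U W(1)
    by blast
  then show "\<exists>x\<in>W. \<forall>n. x \<in> U n"
    by (auto simp: pre_def)
qed

text \<open>For \<open>a\<close> in an open \<open>U\<close>, a section \<open>\<sigma>\<close>
  through \<open>a\<close> pulls \<open>U\<close> back to an open neighbourhood of
  \<open>\<phi> a\<close>, which lies in the image of \<open>U\<close> because
  \<open>\<phi> (\<sigma> b) = b\<close>.\<close>

lemma open_map_sections:
  assumes "\<And>a. a \<in> topspace A \<Longrightarrow>
    \<exists>\<sigma>. continuous_map B A \<sigma> \<and> \<sigma> (\<phi> a) = a \<and> (\<forall>b\<in>topspace B. \<phi> (\<sigma> b) = b)"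
    and "\<phi> ` topspace A \<subseteq> topspace B"
  shows "open_map A B \<phi>"
  unfolding open_map_def
proof (intro allI impI)
  fix U assume U: "openin A U"
  show "openin B (\<phi> ` U)"
  proof (subst openin_subopen, intro ballI)
    fix b assume "b \<in> \<phi> ` U"
    then obtain a where a: "a \<in> U" "b = \<phi> a" "a \<in> topspace A"
      using openin_subset[OF U] by auto
    then obtain \<sigma> where \<sigma>: "continuous_map B A \<sigma>" "\<sigma> b = a" "\<forall>b\<in>topspace B. \<phi> (\<sigma> b) = b"
      using assms(1) by metis
    have "openin B {b \<in> topspace B. \<sigma> b \<in> U}"
      using \<sigma>(1) U by (rule openin_continuous_map_preimage)
    moreover have "b \<in> {b \<in> topspace B. \<sigma> b \<in> U}"
      using a \<sigma> assms(2) by auto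
    moreover have "{b \<in> topspace B. \<sigma> b \<in> U} \<subseteq> \<phi> ` U"
      using \<sigma>(3) by (metis (mono_tags, lifting) imageI mem_Collect_eq subsetI)
    ultimately show "\<exists>T. openin B T \<and> b \<in> T \<and> T \<subseteq> \<phi> ` U"
      by blast
  qed
qed

text \<open>Zorn's lemma. The second components are tags, the states of the tree argument below.
  Pairs with the same nonempty set and different tags count as overlapping, so a point covered by
  the family determines both set and tag.\<close>

lemma ex_maximal_disjoint_subfamily:
  fixes \<B> :: "('a set \<times> 's) set"
  obtains \<M> where "\<M> \<subseteq> \<B>" "pairwise (\<lambda>p q. disjnt (fst p) (fst q)) \<M>"
    "\<And>q. q \<in> \<B> \<Longrightarrow> fst q \<noteq> {} \<Longrightarrow> \<exists>p\<in>\<M>. \<not> disjnt (fst p) (fst q)"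
proof -
  define R where "R = (\<lambda>(p :: 'a set \<times> 's) (q :: 'a set \<times> 's). disjnt (fst p) (fst q))"
  define \<A> where "\<A> = {\<M>. \<M> \<subseteq> \<B> \<and> pairwise R \<M>}"
  have "\<exists>M\<in>\<A>. \<forall>Y\<in>\<A>. M \<subseteq> Y \<longrightarrow> Y = M"
  proof (rule subset_Zorn')
    fix \<C> assume C: "subset.chain \<A> \<C>"
    have "pairwise R (\<Union>\<C>)"
    proof (rule pairwiseI)
      fix p q assume pq: "p \<in> \<Union>\<C>" "q \<in> \<Union>\<C>" "p \<noteq> q"
      then obtain c d where "c \<in> \<C>" "d \<in> \<C>" "p \<in> c" "q \<in> d" by blast
      moreover from this have "pairwise R c" "pairwise R d"
        using C by (auto simp: subset.chain_def \<A>_def)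
      moreover have "c \<subseteq> d \<or> d \<subseteq> c"
        using C \<open>c \<in> \<C>\<close> \<open>d \<in> \<C>\<close> unfolding subset.chain_def by blast
      ultimately show "R p q"
        using pq(3) by (meson in_mono pairwiseD)
    qed
    then show "\<Union>\<C> \<in> \<A>"
      using C by (auto simp: subset.chain_def \<A>_def)
  qed
  then obtain M where M: "M \<in> \<A>" and max: "\<And>Y. Y \<in> \<A> \<Longrightarrow> M \<subseteq> Y \<Longrightarrow> Y = M"
    by blast
  have "\<exists>p\<in>M. \<not> disjnt (fst p) (fst q)" if "q \<in> \<B>" "fst q \<noteq> {}" for q
  proof (rule ccontr)
    assume non: "\<not> ?thesis"
    then have "insert q M \<in> \<A>"
      using M that by (auto simp: \<A>_def R_def pairwise_insert disjnt_sym)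
    \<comment> \<open>A nonempty \<open>fst q\<close> overlaps itself, so \<open>q\<close> would be
      the \<open>p\<close> assumed not to exist.\<close>
    then have "q \<in> M"
      using max[of "insert q M"] by blast
    then show False
      using non that by (auto simp: disjnt_def)
  qed
  then show thesis
    using that[of M] M by (auto simp: \<A>_def R_def)
qed

text \<open>
  A form of the theorem that a Baire space times a complete metric space is Baire. The \<open>\<sigma>\<close>
  are approximations to a point of the second factor; maximal disjoint families make the choice
  of the next approximation depend only on \<open>x\<close>.
\<close>

lemma Baire_space_branch:
  fixes I :: "nat \<Rightarrow> 's \<Rightarrow> bool" and Q :: "nat \<Rightarrow> 's \<Rightarrow> 'a \<Rightarrow> 's \<Rightarrow> bool"
  assumes Baire: "Baire_space A" and ne: "topspace A \<noteq> {}" and init: "I 0 s\<^sub>0"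
    and step: "\<And>n s U. I n s \<Longrightarrow> openin A U \<Longrightarrow> U \<noteq> {} \<Longrightarrow>
      \<exists>U' s'. openin A U' \<and> U' \<noteq> {} \<and> U' \<subseteq> U \<and> I (Suc n) s' \<and> (\<forall>x\<in>U'. Q n s x s')"
  obtains x \<sigma> where "x \<in> topspace A" "\<sigma> 0 = s\<^sub>0" "\<And>n. I n (\<sigma> n)" "\<And>n. Q n (\<sigma> n) x (\<sigma> (Suc n))"
proof -
  \<comment> \<open>A level of a tree: disjoint open sets with dense union, each tagged with a
    state.\<close>
  define good where "good n P \<longleftrightarrow>
      (\<forall>(U, s)\<in>P. openin A U \<and> U \<noteq> {} \<and> I n s) \<and> pairwise (\<lambda>p q. disjnt (fst p) (fst q)) P
      \<and> A closure_of (\<Union>(fst ` P)) = topspace A" for n and P :: "('a set \<times> 's) set"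
  define refines where "refines n P P' \<longleftrightarrow>
      (\<forall>(U', s')\<in>P'. \<exists>(U, s)\<in>P. U' \<subseteq> U \<and> (\<forall>x\<in>U'. Q n s x s'))"
    for n and P P' :: "('a set \<times> 's) set"
  \<comment> \<open>The clause on \<open>n = 0\<close> fixes the root for dependent choice; at
    \<open>Suc n\<close> it is vacuous.\<close>
  have ex: "\<exists>P'. (good (Suc n) P' \<and> (Suc n = 0 \<longrightarrow> P' = {(topspace A, s\<^sub>0)})) \<and> refines n P P'"
    if "good n P \<and> (n = 0 \<longrightarrow> P = {(topspace A, s\<^sub>0)})" for n P
  proof -
    define \<B> where "\<B> = {(U', s'). openin A U' \<and> U' \<noteq> {} \<and> I (Suc n) s' \<and>
        (\<exists>(U, s)\<in>P. U' \<subseteq> U \<and> (\<forall>x\<in>U'. Q n s x s'))}"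
    obtain P' where P': "P' \<subseteq> \<B>" "pairwise (\<lambda>p q. disjnt (fst p) (fst q)) P'"
      and max: "\<And>q. q \<in> \<B> \<Longrightarrow> fst q \<noteq> {} \<Longrightarrow> \<exists>p\<in>P'. \<not> disjnt (fst p) (fst q)"
      using ex_maximal_disjoint_subfamily by blast
    \<comment> \<open>Density of the new level: \<open>step\<close> inside
      \<open>U \<inter> V\<close> yields a member of \<open>\<B>\<close> contained in
      \<open>V\<close>, and by maximality some set of \<open>P'\<close> meets it.\<close>
    have "\<Union>(fst ` P') \<inter> V \<noteq> {}" if V: "openin A V" "V \<noteq> {}" for V
    proof -
      have "\<Union>(fst ` P) \<inter> V \<noteq> {}"
        using V \<open>good n P \<and> _\<close> by (auto simp: good_def dense_intersects_open)
      then obtain U s where Us: "(U, s) \<in> P" "U \<inter> V \<noteq> {}"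
        by force
      moreover have "openin A (U \<inter> V)" "I n s"
        using \<open>good n P \<and> _\<close> Us V by (auto simp: good_def)
      ultimately obtain U' s' where "openin A U'" "U' \<noteq> {}" "U' \<subseteq> U \<inter> V" "I (Suc n) s'"
          "\<forall>x\<in>U'. Q n s x s'"
        using step by metis
      moreover from this have "(U', s') \<in> \<B>"
        using Us by (auto simp: \<B>_def)
      ultimately show ?thesis
        using max[of "(U', s')"] by (fastforce simp: disjnt_def)
    qed
    then have "good (Suc n) P'"
      using P' by (auto simp: good_def dense_intersects_open \<B>_def)
    moreover have "refines n P P'"
      using P'(1) by (auto simp: refines_def \<B>_def)
    ultimately show ?thesis by auto
  qed
  have "good 0 {(topspace A, s\<^sub>0)}"
    using init ne by (auto simp: good_def closure_of_topspace)
  then have "\<exists>P. \<forall>n. (good n (P n) \<and> (n = 0 \<longrightarrow> P n = {(topspace A, s\<^sub>0)})) \<and>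
      refines n (P n) (P (Suc n))"
    by (intro dependent_nat_choice ex) auto
  then obtain P where P: "\<And>n. good n (P n)" "P 0 = {(topspace A, s\<^sub>0)}"
    "\<And>n. refines n (P n) (P (Suc n))"
    by metis
  have "openin A (\<Union>(fst ` P n)) \<and> A closure_of (\<Union>(fst ` P n)) = topspace A" for n
    using P(1)[of n] by (auto simp: good_def intro!: openin_Union)
  then obtain x where x: "x \<in> topspace A" "\<And>n. x \<in> \<Union>(fst ` P n)"
    using Baire[unfolded Baire_space_alt, rule_format, of "\<lambda>n. \<Union>(fst ` P n)" "topspace A"] ne
    by blast
  then have "\<exists>s. \<exists>U. (U, s) \<in> P n \<and> x \<in> U" for n
    by fastforce
  then obtain \<sigma> V where \<sigma>: "\<And>n. (V n, \<sigma> n) \<in> P n" "\<And>n. x \<in> V n"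
    by metis
  have "Q n (\<sigma> n) x (\<sigma> (Suc n))" for n
  proof -
    obtain U s where Us: "(U, s) \<in> P n" "V (Suc n) \<subseteq> U" "\<forall>x\<in>V (Suc n). Q n s x (\<sigma> (Suc n))"
      using P(3)[of n] \<sigma>(1)[of "Suc n"] unfolding refines_def by blast
    \<comment> \<open>Both sets contain \<open>x\<close> and the sets of one level are disjoint, so
      the parent of \<open>V (Suc n)\<close> is \<open>V n\<close> with its own state.\<close>
    moreover have "(U, s) = (V n, \<sigma> n)"
      using P(1)[of n] Us(1,2) \<sigma>(1)[of n] \<sigma>(2)[of n] \<sigma>(2)[of "Suc n"]
      by (fastforce simp: good_def pairwise_def disjnt_iff)
    ultimately show ?thesis
      using \<sigma>(2) by auto
  qed
  moreover have "\<sigma> 0 = s\<^sub>0"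
    using \<sigma>(1)[of 0] P(2) by auto
  moreover have "I n (\<sigma> n)" for n
    using P(1)[of n] \<sigma>(1)[of n] by (auto simp: good_def)
  ultimately show thesis
    using that x(1) by blast
qed

section \<open>Injective choices and interpolation on finite sets\<close>

lemma ex_inj_selector:
  assumes "finite S" "\<And>x. x \<in> S \<Longrightarrow> infinite (O' x)"
  shows "\<exists>v. inj_on v S \<and> (\<forall>x\<in>S. v x \<in> O' x)"
  using assms
proof (induction S)
  case (insert a S)
  then obtain v where v: "inj_on v S" "\<forall>x\<in>S. v x \<in> O' x" by auto
  have "infinite (O' a - v ` S)"
    using insert by (simp add: Diff_infinite_finite)
  then obtain b where "b \<in> O' a" "b \<notin> v ` S"
    by (metis DiffE ex_in_conv finite.emptyI)
  then show ?case
    using v insert.hyps by (intro exI[of _ "v(a := b)"]) (auto simp: inj_on_def)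
qed auto

text \<open>Lagrange interpolation: \<open>b a\<close> is 1 at \<open>a\<close> and 0 on the rest of
  \<open>S\<close>. Finite sets are closed in a Hausdorff space, so complete regularity separates
  \<open>a\<close> from \<open>S - {a}\<close>.\<close>

lemma completely_regular_interpolation:
  fixes v :: "'a \<Rightarrow> real"
  assumes cr: "completely_regular_space X" and "Hausdorff_space X"
    and S: "finite S" "S \<subseteq> topspace X"
  obtains f where "continuous_map X euclideanreal f" "\<And>x. x \<in> S \<Longrightarrow> f x = v x"
proof -
  have "\<exists>f. continuous_map X euclideanreal f \<and> f a = 1 \<and> (\<forall>x\<in>S - {a}. f x = 0)" if "a \<in> S" for a
  proof -
    have "closedin X (S - {a})"
      using S \<open>Hausdorff_space X\<close> by (intro closedin_Hausdorff_finite) auto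
    then obtain f where "continuous_map X (top_of_set {0..1}) f" "f a = (0::real)" "f ` (S - {a}) \<subseteq> {1}"
      using cr[unfolded completely_regular_space_def, rule_format, of "S - {a}" a] \<open>a \<in> S\<close> S
      by auto
    then show ?thesis
      by (intro exI[of _ "\<lambda>x. 1 - f x"])
        (auto simp: continuous_map_in_subtopology intro!: continuous_map_diff)
  qed
  then obtain b where b: "\<And>a. a \<in> S \<Longrightarrow> continuous_map X euclideanreal (b a)"
    "\<And>a. a \<in> S \<Longrightarrow> b a a = (1::real)" "\<And>a x. a \<in> S \<Longrightarrow> x \<in> S - {a} \<Longrightarrow> b a x = 0"
    by metis
  show thesis
  proof
    show "continuous_map X euclideanreal (\<lambda>x. \<Sum>a\<in>S. v a * b a x)"
      using S b(1) by (intro continuous_map_sum continuous_map_real_mult) auto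
    fix x assume "x \<in> S"
    then have "(\<Sum>a\<in>S. v a * b a x) = (\<Sum>a\<in>S. if a = x then v a else 0)"
      using b by (intro sum.cong) auto
    then show "(\<Sum>a\<in>S. v a * b a x) = v x"
      using \<open>x \<in> S\<close> S by simp
  qed
qed

subsection \<open>Spaces of continuous functions\<close>

lemma topspace_Cp: "topspace (Cp X Y) = {f \<in> extensional (topspace X). continuous_map X Y f}"
  by (auto simp: Cp_def continuous_map_def PiE_def)

lemma restrict_in_Cp:
  "continuous_map X Y f \<Longrightarrow> restrict f (topspace X) \<in> topspace (Cp X Y)"
  by (simp add: topspace_Cp continuous_map_eq)

lemma continuous_map_Cp_eval:
  "x \<in> topspace X \<Longrightarrow> continuous_map (Cp X Y) Y (\<lambda>f. f x)"
  unfolding Cp_def by (intro continuous_map_from_subtopology continuous_map_product_projection)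

lemma continuous_map_into_Cp:
  assumes "\<And>z. z \<in> topspace Z \<Longrightarrow> \<phi> z \<in> topspace (Cp X Y)"
    and "\<And>x. x \<in> topspace X \<Longrightarrow> continuous_map Z Y (\<lambda>z. \<phi> z x)"
  shows "continuous_map Z (Cp X Y) \<phi>"
  using assms(2) assms(1)[unfolded topspace_Cp] unfolding Cp_def
  by (auto simp: continuous_map_in_subtopology continuous_map_componentwise)

text \<open>A basic box of the product topology restricts only finitely many coordinates; in the
  others, membership follows from \<open>g\<close> mapping into the space.\<close>

lemma openin_Cp_finite_support:
  assumes "openin (Cp X Y) U" "f \<in> U"
  obtains S O' where "finite S" "S \<subseteq> topspace X" "\<And>x. x \<in> S \<Longrightarrow> openin Y (O' x) \<and> f x \<in> O' x"
    "\<And>g. g \<in> topspace (Cp X Y) \<Longrightarrow> (\<And>x. x \<in> S \<Longrightarrow> g x \<in> O' x) \<Longrightarrow> g \<in> U"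
proof -
  obtain T where T: "openin (product_topology (\<lambda>_. Y) (topspace X)) T" "U = T \<inter> {f. continuous_map X Y f}"
    using assms(1) by (auto simp: Cp_def openin_subtopology)
  then obtain V where V: "finite {x \<in> topspace X. V x \<noteq> topspace Y}" "\<forall>x\<in>topspace X. openin Y (V x)"
    "f \<in> Pi\<^sub>E (topspace X) V" "Pi\<^sub>E (topspace X) V \<subseteq> T"
    using assms(2) unfolding openin_product_topology_alt by blast
  show thesis
  proof (rule that[OF V(1)])
    fix g assume g: "g \<in> topspace (Cp X Y)" "\<And>x. x \<in> {x \<in> topspace X. V x \<noteq> topspace Y} \<Longrightarrow> g x \<in> V x"
    then have "g \<in> Pi\<^sub>E (topspace X) V"
      by (force simp: topspace_Cp PiE_iff continuous_map_def)
    then show "g \<in> U"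
      using V(4) T(2) g(1) by (auto simp: topspace_Cp)
  qed (use V in auto)
qed

subsection \<open>Topological vector spaces\<close>

locale real_topological_vector_space =
  fixes V :: "(real, 'v) module" (structure) and T :: "'v topology"
  assumes tvs: "real_tvs V T"
begin

sublocale module real_field V
  using tvs by (simp add: real_tvs_def)

lemma topspace_T [simp]: "topspace T = carrier V"
  using tvs by (simp add: real_tvs_def)

lemma real_field_simps [simp]: "carrier real_field = (UNIV :: real set)" "a \<oplus>\<^bsub>real_field\<^esub> b = a + b"
    "a \<otimes>\<^bsub>real_field\<^esub> b = a * b" "\<one>\<^bsub>real_field\<^esub> = (1::real)" "\<zero>\<^bsub>real_field\<^esub> = (0::real)"
  by (simp_all add: ring_of_type_algebra_def)

lemma scale_closed [simp]: "x \<in> carrier V \<Longrightarrow> r \<odot> x \<in> carrier V"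
  using smult_closed[of r x] by simp

lemma scale_add_left: "x \<in> carrier V \<Longrightarrow> (r + s) \<odot> x = r \<odot> x \<oplus> s \<odot> x"
  using smult_l_distr[of r s x] by simp

lemma scale_add_right: "x \<in> carrier V \<Longrightarrow> y \<in> carrier V \<Longrightarrow> r \<odot> (x \<oplus> y) = r \<odot> x \<oplus> r \<odot> y"
  using smult_r_distr[of r x y] by simp

lemma scale_scale: "x \<in> carrier V \<Longrightarrow> r \<odot> (s \<odot> x) = (r * s) \<odot> x"
  using smult_assoc1[of r s x] by simp

lemma scale_one [simp]: "x \<in> carrier V \<Longrightarrow> 1 \<odot> x = x"
  using smult_one[of x] by simp

lemma scale_zero_left [simp]: "x \<in> carrier V \<Longrightarrow> 0 \<odot> x = \<zero>"
  using smult_l_null[of x] by simp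

lemma scale_zero_right [simp]: "r \<odot> \<zero> = \<zero>"
  using smult_r_null[of r] by simp

lemma scale_minus_one: "x \<in> carrier V \<Longrightarrow> (-1) \<odot> x = \<ominus> x"
  using scale_add_left[of x "-1" 1] by (simp add: M.minus_equality)

lemma minus_zero [simp]: "\<ominus> \<zero> = \<zero>"
  using M.minus_equality[of \<zero> \<zero>] by simp

lemma scale_minus_left: "x \<in> carrier V \<Longrightarrow> (- r) \<odot> x = \<ominus> (r \<odot> x)"
  using scale_scale[of x "-1" r] by (simp add: scale_minus_one)

lemma scale_minus_right: "x \<in> carrier V \<Longrightarrow> r \<odot> (\<ominus> x) = \<ominus> (r \<odot> x)"
  using scale_scale[of x r "-1"] by (simp add: scale_minus_one scale_minus_left)

lemma diff_add_diff:
  "x \<in> carrier V \<Longrightarrow> y \<in> carrier V \<Longrightarrow> z \<in> carrier V \<Longrightarrow> (x \<ominus> y) \<oplus> (y \<ominus> z) = x \<ominus> z"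
  by (simp add: a_minus_def M.a_assoc M.r_neg1)

lemma diff_self [simp]: "x \<in> carrier V \<Longrightarrow> x \<ominus> x = \<zero>"
  by (simp add: a_minus_def M.r_neg)

lemma minus_diff: "x \<in> carrier V \<Longrightarrow> y \<in> carrier V \<Longrightarrow> \<ominus> (x \<ominus> y) = y \<ominus> x"
  by (simp add: a_minus_def M.minus_add M.a_comm)

lemma diff_add_cancel: "x \<in> carrier V \<Longrightarrow> y \<in> carrier V \<Longrightarrow> (x \<ominus> y) \<oplus> y = x"
  by (simp add: a_minus_def M.a_assoc M.l_neg)

lemma add_diff_cancel: "x \<in> carrier V \<Longrightarrow> y \<in> carrier V \<Longrightarrow> (x \<oplus> y) \<ominus> x = y"
  by (simp add: a_minus_def M.a_assoc M.a_comm[of y] M.r_neg2)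

section \<open>Continuity of the operations and neighbourhoods of the origin\<close>

lemma continuous_map_carrier: "continuous_map Z T f \<Longrightarrow> z \<in> topspace Z \<Longrightarrow> f z \<in> carrier V"
  using continuous_map_image_subset_topspace[of Z T f] by auto

lemma continuous_map_add_tvs:
  assumes "continuous_map Z T f" "continuous_map Z T g"
  shows "continuous_map Z T (\<lambda>z. f z \<oplus> g z)"
proof -
  have "continuous_map (prod_topology T T) T (\<lambda>(x, y). x \<oplus> y)"
    using tvs by (simp add: real_tvs_def)
  moreover have "continuous_map Z (prod_topology T T) (\<lambda>z. (f z, g z))"
    using assms by (simp add: continuous_map_pairedI)
  ultimately show ?thesis
    by (auto dest: continuous_map_compose simp: o_def)
qed

lemma continuous_map_scale_tvs:
  assumes "continuous_map Z euclideanreal r" "continuous_map Z T f"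
  shows "continuous_map Z T (\<lambda>z. r z \<odot> f z)"
proof -
  have "continuous_map (prod_topology euclideanreal T) T (\<lambda>(r, x). r \<odot> x)"
    using tvs by (simp add: real_tvs_def)
  moreover have "continuous_map Z (prod_topology euclideanreal T) (\<lambda>z. (r z, f z))"
    using assms by (simp add: continuous_map_pairedI)
  ultimately show ?thesis
    by (auto dest: continuous_map_compose simp: o_def)
qed

lemma continuous_map_minus_tvs:
  assumes f: "continuous_map Z T f"
  shows "continuous_map Z T (\<lambda>z. \<ominus> f z)"
proof (rule continuous_map_eq)
  show "continuous_map Z T (\<lambda>z. (-1) \<odot> f z)"
    using f by (intro continuous_map_scale_tvs) auto
qed (simp add: scale_minus_one continuous_map_carrier[OF f])

lemma continuous_map_diff_tvs:
  "continuous_map Z T f \<Longrightarrow> continuous_map Z T g \<Longrightarrow> continuous_map Z T (\<lambda>z. f z \<ominus> g z)"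
  unfolding a_minus_def by (intro continuous_map_add_tvs continuous_map_minus_tvs)

text \<open>Such sets may fail to be open, like the convex sets supplied by local convexity.\<close>

definition nbhd0 :: "'v set \<Rightarrow> bool"
  where "nbhd0 S \<longleftrightarrow> (\<exists>U. openin T U \<and> \<zero> \<in> U \<and> U \<subseteq> S)"

lemma nbhd0_Int: "nbhd0 S \<Longrightarrow> nbhd0 S' \<Longrightarrow> nbhd0 (S \<inter> S')"
  unfolding nbhd0_def by (metis IntI Int_mono openin_Int)

lemma nbhd0_zero: "nbhd0 S \<Longrightarrow> \<zero> \<in> S"
  by (auto simp: nbhd0_def)

lemma nbhd0_preimage:
  assumes "nbhd0 S" "continuous_map Z T f" "z\<^sub>0 \<in> topspace Z" "f z\<^sub>0 = \<zero>"
  shows "\<exists>W. openin Z W \<and> z\<^sub>0 \<in> W \<and> (\<forall>z\<in>W. f z \<in> S)"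
proof -
  obtain U where U: "openin T U" "\<zero> \<in> U" "U \<subseteq> S"
    using assms(1) by (auto simp: nbhd0_def)
  have "openin Z {z \<in> topspace Z. f z \<in> U}"
    using assms(2) U(1) by (rule openin_continuous_map_preimage)
  then show ?thesis
    using assms(3,4) U by (intro exI[of _ "{z \<in> topspace Z. f z \<in> U}"]) auto
qed

lemma nbhd0_continuous_map:
  assumes "nbhd0 S" and f: "continuous_map Z T f" and z: "z\<^sub>0 \<in> topspace Z"
  shows "\<exists>W. openin Z W \<and> z\<^sub>0 \<in> W \<and> (\<forall>z\<in>W. f z \<ominus> f z\<^sub>0 \<in> S)"
proof (rule nbhd0_preimage[OF assms(1) _ z])
  show "continuous_map Z T (\<lambda>z. f z \<ominus> f z\<^sub>0)"
    using continuous_map_carrier[OF f z] by (intro continuous_map_diff_tvs f) auto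
qed (simp add: continuous_map_carrier[OF f z])

lemma nbhd0_openin:
  assumes O': "openin T O'" and a: "a \<in> O'"
  shows "nbhd0 {v \<in> carrier V. v \<oplus> a \<in> O'}"
proof -
  have a': "a \<in> carrier V"
    using openin_subset[OF O'] a by auto
  have "continuous_map T T (\<lambda>v. v \<oplus> a)"
    using a' by (intro continuous_map_add_tvs) auto
  then have "openin T {v \<in> topspace T. v \<oplus> a \<in> O'}"
    using O' by (rule openin_continuous_map_preimage)
  then show ?thesis
    unfolding nbhd0_def using a a' by (intro exI[of _ "{v \<in> carrier V. v \<oplus> a \<in> O'}"]) auto
qed

text \<open>Translation by \<open>f z\<^sub>0\<close> turns neighbourhoods of that value into
  neighbourhoods of the origin, so continuity can be tested on differences.\<close>

lemma continuous_mapI_nbhd0: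
  assumes f: "\<And>z. z \<in> topspace Z \<Longrightarrow> f z \<in> carrier V"
    and nb: "\<And>z\<^sub>0 S. z\<^sub>0 \<in> topspace Z \<Longrightarrow> nbhd0 S \<Longrightarrow>
      \<exists>W. openin Z W \<and> z\<^sub>0 \<in> W \<and> (\<forall>z\<in>W. f z \<ominus> f z\<^sub>0 \<in> S)"
  shows "continuous_map Z T f"
  unfolding continuous_map_def
proof (intro conjI allI impI)
  show "f \<in> topspace Z \<rightarrow> topspace T" using f by auto
  fix O' assume O': "openin T O'"
  show "openin Z {z \<in> topspace Z. f z \<in> O'}"
  proof (subst openin_subopen, intro ballI)
    fix z\<^sub>0 assume z: "z\<^sub>0 \<in> {z \<in> topspace Z. f z \<in> O'}"
    then obtain W where W: "openin Z W" "z\<^sub>0 \<in> W"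
      and diff: "\<And>z. z \<in> W \<Longrightarrow> f z \<ominus> f z\<^sub>0 \<in> {v \<in> carrier V. v \<oplus> f z\<^sub>0 \<in> O'}"
      using nb[of z\<^sub>0, OF _ nbhd0_openin[OF O', of "f z\<^sub>0"]] by blast
    have "f z \<in> O'" if "z \<in> W" for z
      using diff[OF that] f that z openin_subset[OF W(1)] by (auto simp: diff_add_cancel subset_iff)
    then show "\<exists>W. openin Z W \<and> z\<^sub>0 \<in> W \<and> W \<subseteq> {z \<in> topspace Z. f z \<in> O'}"
      using W openin_subset[OF W(1)] by (intro exI[of _ W]) auto
  qed
qed

lemma convex_scale:
  assumes "convex_in V S" "S \<subseteq> carrier V" "\<zero> \<in> S" "x \<in> S" "0 \<le> t" "t \<le> 1"
  shows "t \<odot> x \<in> S"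
proof -
  have "(1 - t) \<odot> \<zero> \<oplus> t \<odot> x \<in> S"
    using assms(1,3-6) unfolding convex_in_def by auto
  then show ?thesis
    using assms(2,4) by (simp add: subset_iff)
qed

text \<open>Continuity of addition at the origin gives \<open>A\<close> and \<open>B\<close> with
  sums in \<open>S\<close>. A convex neighbourhood inside both, intersected with its negative, is
  symmetric and still convex.\<close>

lemma ex_small_convex:
  assumes lc: "locally_convex V T" and S: "nbhd0 S"
  obtains C where "C \<subseteq> carrier V" "convex_in V C" "nbhd0 C" "\<And>x. x \<in> C \<Longrightarrow> \<ominus> x \<in> C"
    "\<And>x y. x \<in> C \<Longrightarrow> y \<in> C \<Longrightarrow> x \<oplus> y \<in> S"
proof -
  have "continuous_map (prod_topology T T) T (\<lambda>z. fst z \<oplus> snd z)"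
    by (intro continuous_map_add_tvs continuous_map_fst continuous_map_snd)
  then obtain W where W: "openin (prod_topology T T) W" "(\<zero>, \<zero>) \<in> W" "\<forall>z\<in>W. fst z \<oplus> snd z \<in> S"
    using nbhd0_preimage[OF S, of "prod_topology T T" "\<lambda>z. fst z \<oplus> snd z" "(\<zero>, \<zero>)"] by auto
  then obtain A B where AB: "openin T A" "openin T B" "\<zero> \<in> A" "\<zero> \<in> B" "A \<times> B \<subseteq> W"
    using W(1)[unfolded openin_prod_topology_alt, rule_format, OF W(2)] by auto
  then have "openin T (A \<inter> B)" "\<zero> \<in> A \<inter> B" by auto
  then obtain U C\<^sub>0 where C: "openin T U" "convex_in V C\<^sub>0" "\<zero> \<in> U" "U \<subseteq> C\<^sub>0" "C\<^sub>0 \<subseteq> A \<inter> B"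
    using lc[unfolded locally_convex_def neighbourhood_base_at_def, rule_format, of "A \<inter> B"] by auto
  have car: "C\<^sub>0 \<subseteq> carrier V"
    using C(5) openin_subset[OF AB(1)] by auto
  define C\<^sub>1 where "C\<^sub>1 = {x \<in> C\<^sub>0. \<ominus> x \<in> C\<^sub>0}"
  have comb: "\<ominus> ((1 - t) \<odot> x \<oplus> t \<odot> y) = (1 - t) \<odot> (\<ominus> x) \<oplus> t \<odot> (\<ominus> y)"
    if "x \<in> C\<^sub>0" "y \<in> C\<^sub>0" for x y t
    using that car by (simp add: subset_iff scale_minus_right M.minus_add M.a_comm)
  show thesis
  proof
    show "C\<^sub>1 \<subseteq> carrier V" using car by (auto simp: C\<^sub>1_def)
    show "convex_in V C\<^sub>1"
      using C(2) unfolding convex_in_def C\<^sub>1_def by (auto simp: comb)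
    have "nbhd0 {x \<in> C\<^sub>0. x \<in> U \<and> \<ominus> x \<in> U}"
    proof -
      have "openin T {x \<in> topspace T. \<ominus> x \<in> U}"
        by (rule openin_continuous_map_preimage[OF continuous_map_minus_tvs C(1)]) auto
      then have "openin T (U \<inter> {x \<in> topspace T. \<ominus> x \<in> U})"
        using openin_Int[OF C(1)] by blast
      then show ?thesis
        unfolding nbhd0_def using C(3,4)
        by (intro exI[of _ "U \<inter> {x \<in> topspace T. \<ominus> x \<in> U}"]) auto
    qed
    then show "nbhd0 C\<^sub>1"
      unfolding nbhd0_def C\<^sub>1_def using C(4) by blast
    show "\<ominus> x \<in> C\<^sub>1" if "x \<in> C\<^sub>1" for x
      using that car by (auto simp: C\<^sub>1_def)
    show "x \<oplus> y \<in> S" if "x \<in> C\<^sub>1" "y \<in> C\<^sub>1" for x y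
      using that C(5) AB(5) W(3) by (fastforce simp: C\<^sub>1_def)
  qed
qed

text \<open>The last conjunct serves the induction: the corrections at different points do not interact.\<close>

lemma path_adjust:
  assumes N: "convex_in V N" "N \<subseteq> carrier V" "\<zero> \<in> N"
    and \<gamma>: "continuous_map euclideanreal T \<gamma>" and "finite P"
    and "\<And>p. p \<in> P \<Longrightarrow> w p \<in> carrier V" "\<And>p. p \<in> P \<Longrightarrow> \<bar>p\<bar> \<le> K \<Longrightarrow> w p \<ominus> \<gamma> p \<in> N" "0 < \<delta>"
  shows "\<exists>\<gamma>'. continuous_map euclideanreal T \<gamma>' \<and> (\<forall>p\<in>P. \<gamma>' p = w p) \<and>
    (\<forall>t. \<bar>t\<bar> \<le> K \<longrightarrow> \<gamma>' t \<ominus> \<gamma> t \<in> N) \<and> (\<forall>t. (\<forall>p\<in>P. \<delta> \<le> \<bar>t - p\<bar>) \<longrightarrow> \<gamma>' t = \<gamma> t)"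
  using assms(5-)
proof (induction P arbitrary: \<delta> rule: finite_induct)
  case empty
  have "\<gamma> t \<in> carrier V" for t
    using continuous_map_carrier[OF \<gamma>] by simp
  then show ?case
    using \<gamma> N by (intro exI[of _ \<gamma>]) auto
next
  case (insert a P)
  have car: "\<gamma> t \<in> carrier V" for t
    using continuous_map_carrier[OF \<gamma>] by simp
  \<comment> \<open>If \<open>a\<close> lies outside the interval of radius \<open>K\<close>, the
    correction at \<open>a\<close> must not reach that interval.\<close>
  define \<rho> where "\<rho> = (if \<bar>a\<bar> \<le> K then \<delta> else min \<delta> (\<bar>a\<bar> - K))"
  have \<rho>K: "\<bar>a\<bar> \<le> K" if "\<bar>t\<bar> \<le> K" "\<bar>t - a\<bar> < \<rho>" for t
    using insert.prems(3) that by (auto simp: \<rho>_def split: if_splits)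
  have \<rho>: "\<rho> > 0" "\<rho> \<le> \<delta>"
    using insert.prems(3) by (auto simp: \<rho>_def)
  obtain d where d: "d > 0" "\<forall>p\<in>P. p \<noteq> a \<longrightarrow> d \<le> dist a p"
    using finite_set_avoid[OF insert.hyps(1), of a] by blast
  \<comment> \<open>Half the distance to the other points keeps the
    \<open>\<epsilon>\<close>-intervals around \<open>a\<close> and around each \<open>p\<close> in
    \<open>P\<close> disjoint.\<close>
  define \<epsilon> where "\<epsilon> = min \<rho> (d / 2)"
  have \<epsilon>: "\<epsilon> > 0" "\<epsilon> \<le> \<rho>" "\<And>p. p \<in> P \<Longrightarrow> 2 * \<epsilon> \<le> \<bar>a - p\<bar>"
    using \<rho> d insert.hyps(2) by (auto simp: \<epsilon>_def dist_real_def)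
  obtain \<gamma>\<^sub>1 where cont1: "continuous_map euclideanreal T \<gamma>\<^sub>1" and P1: "\<forall>p\<in>P. \<gamma>\<^sub>1 p = w p"
    and N1: "\<forall>t. \<bar>t\<bar> \<le> K \<longrightarrow> \<gamma>\<^sub>1 t \<ominus> \<gamma> t \<in> N" and off1: "\<forall>t. (\<forall>p\<in>P. \<epsilon> \<le> \<bar>t - p\<bar>) \<longrightarrow> \<gamma>\<^sub>1 t = \<gamma> t"
    using insert.IH[of \<epsilon>] insert.prems \<epsilon>(1) by auto
  have car1: "\<gamma>\<^sub>1 t \<in> carrier V" for t
    using continuous_map_carrier[OF cont1] by simp
  define u where "u = w a \<ominus> \<gamma> a"
  have u: "u \<in> carrier V"
    using insert.prems car by (simp add: u_def)
  \<comment> \<open>A tent function: adding \<open>\<beta> t \<odot> u\<close> repairs the value at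
    \<open>a\<close> and changes nothing at distance \<open>\<epsilon>\<close> or more.\<close>
  define \<beta> where "\<beta> t = max 0 (1 - \<bar>t - a\<bar> / \<epsilon>)" for t
  have \<beta>: "0 \<le> \<beta> t" "\<beta> t \<le> 1" and \<beta>0: "\<epsilon> \<le> \<bar>t - a\<bar> \<Longrightarrow> \<beta> t = 0" and \<beta>1: "\<beta> a = 1" for t
    using \<epsilon>(1) by (auto simp: \<beta>_def)
  define \<gamma>\<^sub>2 where "\<gamma>\<^sub>2 t = \<gamma>\<^sub>1 t \<oplus> \<beta> t \<odot> u" for t
  have near: "\<gamma>\<^sub>1 t = \<gamma> t" if "\<bar>t - a\<bar> < \<epsilon>" for t
    using off1 \<epsilon>(3) that by (smt (verit, best))
  have far: "\<gamma>\<^sub>2 t = \<gamma>\<^sub>1 t" if "\<epsilon> \<le> \<bar>t - a\<bar>" for t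
    using \<beta>0[OF that] u car1 by (simp add: \<gamma>\<^sub>2_def)
  show ?case
  proof (intro exI[of _ \<gamma>\<^sub>2] conjI ballI allI impI)
    have "continuous_on UNIV \<beta>"
      unfolding \<beta>_def using \<epsilon>(1) by (intro continuous_intros) auto
    then show "continuous_map euclideanreal T \<gamma>\<^sub>2"
      unfolding \<gamma>\<^sub>2_def using u
      by (intro continuous_map_add_tvs continuous_map_scale_tvs cont1) auto
    show "\<gamma>\<^sub>2 p = w p" if "p \<in> insert a P" for p
    proof (cases "p = a")
      case True
      have "\<gamma> a \<oplus> (w a \<ominus> \<gamma> a) = w a"
        using insert.prems car M.a_comm[of "\<gamma> a" "w a \<ominus> \<gamma> a"] by (simp add: diff_add_cancel)
      then show ?thesis
        using True near[of a] \<epsilon>(1) u by (simp add: \<gamma>\<^sub>2_def \<beta>1 u_def)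
    next
      case False
      then show ?thesis
        using that \<epsilon>(1) \<epsilon>(3)[of p] far[of p] P1 by auto
    qed
    show "\<gamma>\<^sub>2 t \<ominus> \<gamma> t \<in> N" if "\<bar>t\<bar> \<le> K" for t
    proof (cases "\<bar>t - a\<bar> < \<epsilon>")
      case True
      \<comment> \<open>By the choice of \<open>\<rho>\<close>, a point of the tent inside the
        interval forces \<open>a\<close> inside too, so the hypothesis on \<open>w a\<close>
        applies.\<close>
      then have "u \<in> N"
        using insert.prems(2)[of a] \<rho>K[OF that] \<epsilon>(2) by (simp add: u_def)
      then have "\<beta> t \<odot> u \<in> N"
        using convex_scale[OF N] \<beta> by blast
      then show ?thesis
        using near[OF True] u car by (simp add: \<gamma>\<^sub>2_def add_diff_cancel)
    qed (use that N1 far in auto)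
    show "\<gamma>\<^sub>2 t = \<gamma> t" if "\<forall>p\<in>insert a P. \<delta> \<le> \<bar>t - p\<bar>" for t
    proof -
      have "\<epsilon> \<le> \<delta>" using \<epsilon>(2) \<rho>(2) by simp
      then have "\<forall>p\<in>insert a P. \<epsilon> \<le> \<bar>t - p\<bar>" using that by force
      then show ?thesis using off1 far by auto
    qed
  qed
qed

end

text \<open>
  A substitute for a translation-invariant metric: \<open>B\<close> plays the role of the balls of radius
  \<open>2 ^ (-n)\<close> around the origin.
\<close>

locale tvs_with_base = real_topological_vector_space +
  fixes B :: "nat \<Rightarrow> 'a set"
  assumes B_carrier: "B n \<subseteq> carrier V"
    and B_convex: "convex_in V (B n)"
    and B_nbhd0: "nbhd0 (B n)"
    and B_minus: "x \<in> B n \<Longrightarrow> \<ominus> x \<in> B n"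
    and B_add: "x \<in> B (Suc n) \<Longrightarrow> y \<in> B (Suc n) \<Longrightarrow> x \<oplus> y \<in> B n"
    and B_base: "nbhd0 S \<Longrightarrow> \<exists>n. B n \<subseteq> S"
begin

lemma B_zero: "\<zero> \<in> B n"
  using B_nbhd0 by (rule nbhd0_zero)

lemma B_antimono: "m \<le> n \<Longrightarrow> B n \<subseteq> B m"
proof (induction rule: dec_induct)
  case (step n)
  have "B (Suc n) \<subseteq> B n"
    using B_add[OF _ B_zero, of _ n] B_carrier[of "Suc n"] by fastforce
  then show ?case using step by blast
qed simp

lemma B_diff_trans:
  assumes "x \<in> carrier V" "y \<in> carrier V" "z \<in> carrier V" "x \<ominus> y \<in> B (Suc n)" "y \<ominus> z \<in> B (Suc n)"
  shows "x \<ominus> z \<in> B n"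
  using B_add[OF assms(4,5)] assms(1-3) by (simp add: diff_add_diff)

lemma B_diff_sym:
  "x \<in> carrier V \<Longrightarrow> y \<in> carrier V \<Longrightarrow> x \<ominus> y \<in> B n \<Longrightarrow> y \<ominus> x \<in> B n"
  using B_minus[of "x \<ominus> y" n] by (simp add: minus_diff)

text \<open>The index \<open>m k + 2\<close> leaves two levels of room: one is spent on summing all
  later jumps, one on passing to the limit.\<close>

lemma ex_limit:
  fixes m :: "nat \<Rightarrow> nat"
  assumes "tvs_complete V T" and x: "\<And>k. x k \<in> carrier V"
    and m: "\<And>k. m k < m (Suc k)" and step: "\<And>k. x (Suc k) \<ominus> x k \<in> B (m k + 2)"
  obtains l where "l \<in> carrier V" "\<And>k. l \<ominus> x k \<in> B (m k)"
proof -
  have close: "x (k + j) \<ominus> x k \<in> B (Suc (m k))" for k j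
  proof (induction j arbitrary: k)
    case (Suc j)
    \<comment> \<open>The first jump is split off; the rest starts at \<open>Suc k\<close>, where
      strict growth of \<open>m\<close> gives a bound in \<open>B (m k + 2)\<close>, so the two sum
      into \<open>B (m k + 1)\<close>.\<close>
    have "x (Suc k + j) \<ominus> x (Suc k) \<in> B (Suc (Suc (m k)))"
      using Suc.IH[of "Suc k"] B_antimono[of "Suc (Suc (m k))" "Suc (m (Suc k))"] m[of k] by auto
    then show ?case
      using step[of k] B_diff_trans[of "x (Suc k + j)" "x (Suc k)" "x k"] x by simp
  qed (simp add: x B_zero)
  have mk: "k \<le> m k" for k
    using strict_mono_imp_increasing[of m k] m by (simp add: strict_mono_Suc_iff)
  have "tvs_cauchy_filter V T (filtermap x sequentially)"
    unfolding tvs_cauchy_filter_def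
  proof (intro conjI allI impI)
    fix U assume U: "openin T U \<and> \<zero> \<in> U"
    then obtain n where n: "B n \<subseteq> U"
      using B_base[of U] by (auto simp: nbhd0_def)
    have "x i \<ominus> x j \<in> U" if "i \<ge> n" "j \<ge> n" for i j
    proof -
      have "x i \<ominus> x n \<in> B (Suc (m n))" "x j \<ominus> x n \<in> B (Suc (m n))"
        using close[of n "i - n"] close[of n "j - n"] that by auto
      then have "x i \<ominus> x j \<in> B (m n)"
        using B_diff_trans[of "x i" "x n" "x j"] B_diff_sym[of "x j" "x n"] x by simp
      then show ?thesis
        using n B_antimono[OF mk[of n]] by blast
    qed
    then show "\<exists>A\<subseteq>carrier V. (\<forall>\<^sub>F x in filtermap x sequentially. x \<in> A) \<and> (\<forall>x\<in>A. \<forall>y\<in>A. x \<ominus> y \<in> U)"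
      using x by (intro exI[of _ "x ` {n..}"])
        (auto simp: eventually_filtermap eventually_sequentially intro!: exI[of _ n])
  qed (use x in \<open>auto simp: eventually_filtermap filtermap_bot_iff\<close>)
  then obtain l where l: "limitin T (\<lambda>x. x) l (filtermap x sequentially)"
    using assms(1) unfolding tvs_complete_def by blast
  then have lV: "l \<in> carrier V"
    by (simp add: limitin_def)
  moreover have "l \<ominus> x k \<in> B (m k)" for k
  proof -
    \<comment> \<open>This map vanishes at \<open>l\<close>, so it is small at \<open>x j\<close>
      for some late \<open>j\<close>.\<close>
    have "continuous_map T T (\<lambda>v. l \<ominus> v)"
      using lV by (intro continuous_map_diff_tvs) auto
    then obtain W where W: "openin T W" "l \<in> W" "\<forall>v\<in>W. l \<ominus> v \<in> B (Suc (m k))"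
      using nbhd0_preimage[OF B_nbhd0, of T "\<lambda>v. l \<ominus> v" l] lV by auto
    then have "\<forall>\<^sub>F j in sequentially. x j \<in> W"
      using l by (auto simp: limitin_def eventually_filtermap)
    then obtain j where "j \<ge> k" "x j \<in> W"
      unfolding eventually_sequentially by (meson nle_le)
    moreover have "x j \<ominus> x k \<in> B (Suc (m k))"
      using close[of k "j - k"] \<open>j \<ge> k\<close> by simp
    ultimately show ?thesis
      using B_diff_trans[of l "x j" "x k"] lV x W(3) by simp
  qed
  ultimately show thesis
    using that by blast
qed

end

text \<open>Metrizability gives a countable base \<open>W\<close> at the origin. Each new set is
  convex, symmetric, contained in \<open>W (Suc n)\<close>, and has its pairwise sums in the
  previous set; the inclusion comes from \<open>x = x + 0\<close>.\<close>

lemma frechet_space_imp_base: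
  assumes "frechet_space V T"
  obtains B where "tvs_with_base V T B"
proof -
  interpret real_topological_vector_space V T
    using assms by unfold_locales (simp add: frechet_space_def)
  have lc: "locally_convex V T" and "first_countable T"
    using assms metrizable_imp_first_countable by (auto simp: frechet_space_def)
  then obtain \<B> where \<B>: "countable \<B>" "\<And>U. U \<in> \<B> \<Longrightarrow> openin T U"
    "\<And>U. openin T U \<Longrightarrow> \<zero>\<^bsub>V\<^esub> \<in> U \<Longrightarrow> \<exists>W\<in>\<B>. \<zero>\<^bsub>V\<^esub> \<in> W \<and> W \<subseteq> U"
    unfolding first_countable_def by (metis M.zero_closed topspace_T)
  define \<B>\<^sub>0 where "\<B>\<^sub>0 = {W \<in> \<B>. \<zero>\<^bsub>V\<^esub> \<in> W}"
  have ne: "\<B>\<^sub>0 \<noteq> {}" "countable \<B>\<^sub>0"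
    using \<B>(1) \<B>(3)[OF openin_topspace] by (auto simp: \<B>\<^sub>0_def)
  define W where "W = from_nat_into \<B>\<^sub>0"
  have W: "nbhd0 (W n)" for n
    using from_nat_into[OF ne(1), of n] \<B>(2) by (auto simp: W_def \<B>\<^sub>0_def nbhd0_def)
  define nice where "nice C \<longleftrightarrow> C \<subseteq> carrier V \<and> convex_in V C \<and> nbhd0 C \<and> (\<forall>x\<in>C. \<ominus>\<^bsub>V\<^esub> x \<in> C)" for C
  have ex: "\<exists>C. (nice C \<and> C \<subseteq> S) \<and> (\<forall>x\<in>C. \<forall>y\<in>C. x \<oplus>\<^bsub>V\<^esub> y \<in> S)" if S: "nbhd0 S" for S
  proof -
    obtain C where C: "nice C" "\<forall>x\<in>C. \<forall>y\<in>C. x \<oplus>\<^bsub>V\<^esub> y \<in> S"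
      unfolding nice_def using ex_small_convex[OF lc S] by metis
    have "x \<in> S" if "x \<in> C" for x
    proof -
      have "x \<oplus>\<^bsub>V\<^esub> \<zero>\<^bsub>V\<^esub> \<in> S" "x \<in> carrier V"
        using that C nbhd0_zero[of C] by (auto simp: nice_def)
      then show ?thesis by simp
    qed
    then show ?thesis
      using C by (intro exI[of _ C]) auto
  qed
  have "\<exists>B. \<forall>n. (nice (B n) \<and> B n \<subseteq> W n) \<and> (\<forall>x\<in>B (Suc n). \<forall>y\<in>B (Suc n). x \<oplus>\<^bsub>V\<^esub> y \<in> B n)"
  proof (rule dependent_nat_choice)
    show "\<exists>C. nice C \<and> C \<subseteq> W 0"
      using ex[OF W[of 0]] by auto
    fix C n assume "nice C \<and> C \<subseteq> W n"
    then have "nbhd0 (C \<inter> W (Suc n))"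
      using W by (intro nbhd0_Int) (auto simp: nice_def)
    from ex[OF this]
    show "\<exists>C'. (nice C' \<and> C' \<subseteq> W (Suc n)) \<and> (\<forall>x\<in>C'. \<forall>y\<in>C'. x \<oplus>\<^bsub>V\<^esub> y \<in> C)"
      by (elim exE, intro exI) auto
  qed
  then obtain B where B: "\<And>n. nice (B n)" "\<And>n. B n \<subseteq> W n"
    "\<And>n x y. x \<in> B (Suc n) \<Longrightarrow> y \<in> B (Suc n) \<Longrightarrow> x \<oplus>\<^bsub>V\<^esub> y \<in> B n"
    by metis
  have "\<exists>n. B n \<subseteq> S" if S: "nbhd0 S" for S
  proof -
    obtain U where U: "openin T U" "\<zero>\<^bsub>V\<^esub> \<in> U" "U \<subseteq> S"
      using S by (auto simp: nbhd0_def)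
    obtain W' where W': "W' \<in> \<B>\<^sub>0" "W' \<subseteq> S"
      using \<B>(3)[OF U(1,2)] U(3) by (auto simp: \<B>\<^sub>0_def)
    then obtain n where "W n = W'"
      using from_nat_into_surj[OF ne(2)] by (auto simp: W_def)
    then show ?thesis
      using B(2)[of n] W' by auto
  qed
  then have "tvs_with_base V T B"
    using B by unfold_locales (auto simp: nice_def)
  then show thesis by (rule that)
qed

subsection \<open>From real functions to vector-valued functions\<close>

lemma openin_Cp_finite:
  assumes "finite S" "S \<subseteq> topspace X" "\<And>x. x \<in> S \<Longrightarrow> openin Y (G x)"
  shows "openin (Cp X Y) {g \<in> topspace (Cp X Y). \<forall>x\<in>S. g x \<in> G x}"
proof -
  have "openin (Cp X Y) {g \<in> topspace (Cp X Y). g x \<in> G x}" if "x \<in> S" for x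
    using that assms by (intro openin_continuous_map_preimage[OF continuous_map_Cp_eval]) auto
  then have "openin (Cp X Y) (topspace (Cp X Y) \<inter> (\<Inter>x\<in>S. {g \<in> topspace (Cp X Y). g x \<in> G x}))"
    using assms(1) by (intro openin_Int_Inter) auto
  moreover have "topspace (Cp X Y) \<inter> (\<Inter>x\<in>S. {g \<in> topspace (Cp X Y). g x \<in> G x}) =
      {g \<in> topspace (Cp X Y). \<forall>x\<in>S. g x \<in> G x}"
    by auto
  ultimately show ?thesis by simp
qed

context tvs_with_base
begin

text \<open>Translating each coordinate to the origin gives an index for each point of
  \<open>S\<close>; since \<open>B\<close> decreases, the largest one serves all of them.\<close>

lemma openin_Cp_basic:
  assumes D: "openin (Cp X T) D" "h \<in> D"
  obtains S n where "finite S" "S \<subseteq> topspace X"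
    "\<And>g. g \<in> topspace (Cp X T) \<Longrightarrow> (\<And>x. x \<in> S \<Longrightarrow> g x \<ominus> h x \<in> B n) \<Longrightarrow> g \<in> D"
proof -
  obtain S O' where S: "finite S" "S \<subseteq> topspace X" "\<And>x. x \<in> S \<Longrightarrow> openin T (O' x) \<and> h x \<in> O' x"
    and sub: "\<And>g. g \<in> topspace (Cp X T) \<Longrightarrow> (\<And>x. x \<in> S \<Longrightarrow> g x \<in> O' x) \<Longrightarrow> g \<in> D"
    using openin_Cp_finite_support[OF D] by blast
  have "\<exists>n. B n \<subseteq> {v \<in> carrier V. v \<oplus> h x \<in> O' x}" if "x \<in> S" for x
    using S(3)[OF that] by (intro B_base nbhd0_openin) auto
  then obtain n where n: "\<And>x. x \<in> S \<Longrightarrow> B (n x) \<subseteq> {v \<in> carrier V. v \<oplus> h x \<in> O' x}"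
    by metis
  \<comment> \<open>For empty \<open>S\<close> the maximum is unspecified, but then it bounds
    nothing.\<close>
  have Suniform: "B (Max (n ` S)) \<subseteq> B (n x)" if "x \<in> S" for x
    using that S(1) by (intro B_antimono) auto
  have "h \<in> topspace (Cp X T)"
    using D openin_subset by blast
  then have h: "h x \<in> carrier V" if "x \<in> S" for x
    using that S(2) continuous_map_carrier[of X h x] by (auto simp: topspace_Cp)
  show thesis
  proof (rule that[OF S(1,2)])
    fix g assume g: "g \<in> topspace (Cp X T)" "\<And>x. x \<in> S \<Longrightarrow> g x \<ominus> h x \<in> B (Max (n ` S))"
    show "g \<in> D"
    proof (rule sub[OF g(1)])
      fix x assume x: "x \<in> S"
      then have "g x \<in> carrier V"
        using g(1) S(2) continuous_map_carrier[of X g x] by (auto simp: topspace_Cp)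
      moreover have "(g x \<ominus> h x) \<oplus> h x \<in> O' x"
        using g(2)[OF x] Suniform[OF x] n[OF x] by auto
      ultimately show "g x \<in> O' x"
        using h[OF x] by (simp add: diff_add_cancel)
    qed
  qed
qed

text \<open>
  For \<open>K < 0\<close> the path \<open>\<gamma>\<close> imposes no constraint; this lets the first step aim at an arbitrary
  nonempty open set.
\<close>

lemma approximate_by_path:
  fixes K :: real
  assumes X: "completely_regular_space X" "Hausdorff_space X"
    and U: "openin (Cp X euclideanreal) U" "f\<^sub>0 \<in> U"
    and D: "openin (Cp X T) D" "D \<noteq> {}" "K < 0 \<or> Cp X T closure_of D = topspace (Cp X T)"
    and \<gamma>: "continuous_map euclideanreal T \<gamma>"
  obtains U' \<gamma>' K' m' where "openin (Cp X euclideanreal) U'" "U' \<noteq> {}" "U' \<subseteq> U"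
    "continuous_map euclideanreal T \<gamma>'" "K + 1 \<le> K'" "m < m'"
    "\<And>t. \<bar>t\<bar> \<le> K \<Longrightarrow> \<gamma>' t \<ominus> \<gamma> t \<in> B (m + 2)"
    "\<And>f \<eta>. f \<in> U' \<Longrightarrow> continuous_map euclideanreal T \<eta> \<Longrightarrow>
      (\<And>t. \<bar>t\<bar> \<le> K' \<Longrightarrow> \<eta> t \<ominus> \<gamma>' t \<in> B m') \<Longrightarrow> restrict (\<eta> \<circ> f) (topspace X) \<in> D"
proof -
  have \<gamma>V: "\<gamma> t \<in> carrier V" for t
    using continuous_map_carrier[OF \<gamma>] by simp
  have f\<^sub>0: "f\<^sub>0 \<in> topspace (Cp X euclideanreal)"
    using U openin_subset by blast
  obtain A O' where A: "finite A" "A \<subseteq> topspace X" "\<And>x. x \<in> A \<Longrightarrow> openin euclideanreal (O' x) \<and> f\<^sub>0 x \<in> O' x"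
    and AU: "\<And>g. g \<in> topspace (Cp X euclideanreal) \<Longrightarrow> (\<And>x. x \<in> A \<Longrightarrow> g x \<in> O' x) \<Longrightarrow> g \<in> U"
    using openin_Cp_finite_support[OF U] by blast
  \<comment> \<open>For \<open>K \<ge> 0\<close>, density of \<open>D\<close> gives \<open>h\<close>
    near \<open>\<gamma> \<circ> f\<^sub>0\<close> on \<open>A\<close>. For \<open>K < 0\<close> the
    guard makes the closeness vacuous and any element of \<open>D\<close> will do.\<close>
  obtain h where h: "h \<in> D" and hA: "\<And>x. x \<in> A \<Longrightarrow> 0 \<le> K \<Longrightarrow> h x \<ominus> \<gamma> (f\<^sub>0 x) \<in> B (Suc (m + 2))"
  proof (cases "K < 0")
    case True
    then show thesis using that D(2) by fastforce
  next
    case False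
    obtain Q where Q: "openin T Q" "\<zero> \<in> Q" "Q \<subseteq> B (Suc (m + 2))"
      using B_nbhd0 by (auto simp: nbhd0_def)
    define G where "G x = {y \<in> topspace T. y \<ominus> \<gamma> (f\<^sub>0 x) \<in> Q}" for x
    have G: "openin T (G x)" for x
      unfolding G_def using \<gamma>V
      by (intro openin_continuous_map_preimage[OF continuous_map_diff_tvs Q(1)]) auto
    define W where "W = {g \<in> topspace (Cp X T). \<forall>x\<in>A. g x \<in> G x}"
    have "openin (Cp X T) W"
      unfolding W_def using A G by (intro openin_Cp_finite)
    moreover have "restrict (\<gamma> \<circ> f\<^sub>0) (topspace X) \<in> W"
      using f\<^sub>0 A(2) \<gamma>V Q(2) continuous_map_compose[OF _ \<gamma>, of X f\<^sub>0] restrict_in_Cp[of X T "\<gamma> \<circ> f\<^sub>0"]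
      by (auto simp: W_def G_def subset_iff topspace_Cp)
    ultimately obtain h where "h \<in> D" "h \<in> W"
      using D(3) False unfolding dense_intersects_open by auto
    then show thesis
      using that Q(3) by (auto simp: W_def G_def)
  qed
  obtain A' n where A': "finite A'" "A' \<subseteq> topspace X"
    and A'D: "\<And>g. g \<in> topspace (Cp X T) \<Longrightarrow> (\<And>x. x \<in> A' \<Longrightarrow> g x \<ominus> h x \<in> B n) \<Longrightarrow> g \<in> D"
    using openin_Cp_basic[OF D(1) h] by blast
  define S where "S = A \<union> A'"
  have S: "finite S" "S \<subseteq> topspace X"
    using A A' by (auto simp: S_def)
  have "h \<in> topspace (Cp X T)"
    using h D(1) openin_subset by blast
  then have hV: "h x \<in> carrier V" if "x \<in> S" for x
    using that S(2) continuous_map_carrier[of X h x] by (auto simp: topspace_Cp)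

  \<comment> \<open>Admissible values at \<open>x\<close>. On \<open>A\<close> the new function must
    stay in \<open>U\<close> and where \<open>\<gamma>\<close> has hardly moved; elsewhere it is
    sent beyond \<open>K\<close>, where the path may be changed freely.\<close>
  define R where "R x = (if x \<in> A then {t \<in> O' x. \<gamma> t \<ominus> \<gamma> (f\<^sub>0 x) \<in> B (Suc (m + 2))} else {K<..})" for x
  have "infinite (R x)" for x
  proof (cases "x \<in> A")
    case True
    obtain W where W: "openin euclideanreal W" "f\<^sub>0 x \<in> W" "\<forall>t\<in>W. \<gamma> t \<ominus> \<gamma> (f\<^sub>0 x) \<in> B (Suc (m + 2))"
      using nbhd0_continuous_map[OF B_nbhd0[of "Suc (m + 2)"] \<gamma>, of "f\<^sub>0 x"] by auto
    then have "open (O' x \<inter> W)" "O' x \<inter> W \<noteq> {}"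
      using A(3)[OF True] by auto
    then have "infinite (O' x \<inter> W)"
      using finite_imp_not_open by blast
    then show ?thesis
      by (rule infinite_super[rotated]) (use True W(3) in \<open>auto simp: R_def\<close>)
  qed (simp add: R_def infinite_Ioi)
  then obtain v where v: "inj_on v S" "\<And>x. x \<in> S \<Longrightarrow> v x \<in> R x"
    using ex_inj_selector[of S R] S(1) by blast
  obtain f where f: "continuous_map X euclideanreal f" "\<And>x. x \<in> S \<Longrightarrow> f x = v x"
    using completely_regular_interpolation[OF X S, of v] by blast
  define f\<^sub>1 where "f\<^sub>1 = restrict f (topspace X)"
  have f1: "f\<^sub>1 \<in> topspace (Cp X euclideanreal)" "\<And>x. x \<in> S \<Longrightarrow> f\<^sub>1 x = v x"
    using f S(2) restrict_in_Cp by (auto simp: f\<^sub>1_def)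
  have "f\<^sub>1 x \<in> O' x" if "x \<in> A" for x
    using that f1(2)[of x] v(2)[of x] by (simp add: S_def R_def)
  then have f1U: "f\<^sub>1 \<in> U"
    using AU f1(1) by blast

  define w where "w p = h (inv_into S v p)" for p
  have w: "w (v x) = h x" if "x \<in> S" for x
    using that v(1) by (simp add: w_def)
  \<comment> \<open>Only points of \<open>A\<close> can have \<open>v x\<close> inside the interval,
    and for them \<open>h x\<close> and \<open>\<gamma> (v x)\<close> are both close to
    \<open>\<gamma> (f\<^sub>0 x)\<close>.\<close>
  have near: "h x \<ominus> \<gamma> (v x) \<in> B (m + 2)" if x: "x \<in> S" "\<bar>v x\<bar> \<le> K" for x
  proof -
    have xA: "x \<in> A"
      using v(2)[OF x(1)] x(2) by (auto simp: R_def split: if_splits)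
    then have "h x \<ominus> \<gamma> (f\<^sub>0 x) \<in> B (Suc (m + 2))" "\<gamma> (v x) \<ominus> \<gamma> (f\<^sub>0 x) \<in> B (Suc (m + 2))"
      using hA x v(2)[OF x(1)] by (auto simp: R_def)
    then show ?thesis
      using B_diff_trans[of "h x" "\<gamma> (f\<^sub>0 x)" "\<gamma> (v x)" "m + 2"] B_diff_sym[of "\<gamma> (v x)" "\<gamma> (f\<^sub>0 x)"]
        hV[OF x(1)] \<gamma>V by simp
  qed
  have "\<exists>\<gamma>'. continuous_map euclideanreal T \<gamma>' \<and> (\<forall>p\<in>v ` S. \<gamma>' p = w p) \<and>
      (\<forall>t. \<bar>t\<bar> \<le> K \<longrightarrow> \<gamma>' t \<ominus> \<gamma> t \<in> B (m + 2)) \<and> (\<forall>t. (\<forall>p\<in>v ` S. 1 \<le> \<bar>t - p\<bar>) \<longrightarrow> \<gamma>' t = \<gamma> t)"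
    by (rule path_adjust[OF B_convex B_carrier B_zero \<gamma>]) (use S(1) w hV near in auto)
  then obtain \<gamma>' where \<gamma>': "continuous_map euclideanreal T \<gamma>'" "\<And>x. x \<in> S \<Longrightarrow> \<gamma>' (v x) = h x"
    "\<And>t. \<bar>t\<bar> \<le> K \<Longrightarrow> \<gamma>' t \<ominus> \<gamma> t \<in> B (m + 2)"
    using w by auto
  have \<gamma>'V: "\<gamma>' t \<in> carrier V" for t
    using continuous_map_carrier[OF \<gamma>'(1)] by simp

  \<comment> \<open>The sum makes the interval of radius \<open>K'\<close> contain the unit balls
    around all \<open>v x\<close>.\<close>
  define K' where "K' = \<bar>K\<bar> + 1 + (\<Sum>x\<in>S. \<bar>v x\<bar>)"
  have "K + 1 \<le> K'"
    using sum_nonneg[of S "\<lambda>x. \<bar>v x\<bar>"] abs_ge_self[of K] unfolding K'_def by linarith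
  moreover have "\<bar>v x\<bar> + 1 \<le> K'" if "x \<in> S" for x
    using that S(1) member_le_sum[of x S "\<lambda>x. \<bar>v x\<bar>"] by (simp add: K'_def)
  ultimately have K': "K + 1 \<le> K'" "\<And>x. x \<in> S \<Longrightarrow> \<bar>v x\<bar> + 1 \<le> K'"
    by blast+
  \<comment> \<open>Larger than \<open>m\<close>, and fine enough for errors in
    \<open>B (Suc n)\<close>.\<close>
  define m' where "m' = max (Suc m) (Suc n)"
  have "\<exists>W. openin euclideanreal W \<and> p \<in> W \<and> (\<forall>t\<in>W. \<gamma>' t \<ominus> \<gamma>' p \<in> B (Suc n))" for p
    using nbhd0_continuous_map[OF B_nbhd0 \<gamma>'(1)] by simp
  then obtain W where W: "\<And>p. open (W p)" "\<And>p. p \<in> W p" "\<And>p t. t \<in> W p \<Longrightarrow> \<gamma>' t \<ominus> \<gamma>' p \<in> B (Suc n)"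
    by simp metis
  \<comment> \<open>For \<open>g\<close> in \<open>U'\<close>, \<open>g x\<close> stays in the
    interval controlled by \<open>K'\<close>, and \<open>\<gamma>' (g x)\<close> is close to
    \<open>\<gamma>' (v x) = h x\<close>. The errors from moving the argument and from replacing
    \<open>\<gamma>'\<close> by \<open>\<eta>\<close> are in \<open>B (Suc n)\<close> and add up to
    \<open>B n\<close>.\<close>
  define U' where "U' = U \<inter> {g \<in> topspace (Cp X euclideanreal). \<forall>x\<in>S. g x \<in> W (v x) \<inter> ball (v x) 1}"
  show thesis
  proof (rule that)
    show "openin (Cp X euclideanreal) U'"
      unfolding U'_def using S U(1) W(1) by (intro openin_Int openin_Cp_finite) auto
    show "U' \<noteq> {}" "U' \<subseteq> U"
      using f1 f1U W(2) by (auto simp: U'_def)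
    show "m < m'" by (simp add: m'_def)
    fix g \<eta> assume g: "g \<in> U'" and \<eta>: "continuous_map euclideanreal T \<eta>"
      and close: "\<And>t. \<bar>t\<bar> \<le> K' \<Longrightarrow> \<eta> t \<ominus> \<gamma>' t \<in> B m'"
    have gc: "continuous_map X euclideanreal g"
      using g by (simp add: U'_def topspace_Cp)
    show "restrict (\<eta> \<circ> g) (topspace X) \<in> D"
    proof (rule A'D)
      show "restrict (\<eta> \<circ> g) (topspace X) \<in> topspace (Cp X T)"
        using gc \<eta> by (intro restrict_in_Cp continuous_map_compose)
      fix x assume "x \<in> A'"
      then have x: "x \<in> S" by (simp add: S_def)
      then have gx: "g x \<in> W (v x)" "dist (v x) (g x) < 1"
        using g by (auto simp: U'_def)
      then have "\<bar>g x\<bar> \<le> K'"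
        using K'(2)[OF x] by (auto simp: dist_real_def)
      then have "\<eta> (g x) \<ominus> \<gamma>' (g x) \<in> B (Suc n)"
        using close B_antimono[of "Suc n" m'] by (auto simp: m'_def)
      moreover have "\<gamma>' (g x) \<ominus> h x \<in> B (Suc n)"
        using W(3)[OF gx(1)] \<gamma>'(2)[OF x] by simp
      ultimately have "\<eta> (g x) \<ominus> h x \<in> B n"
        using B_diff_trans[of "\<eta> (g x)" "\<gamma>' (g x)" "h x"] hV[OF x] \<gamma>'V
          continuous_map_carrier[OF \<eta>] by simp
      then show "restrict (\<eta> \<circ> g) (topspace X) x \<ominus> h x \<in> B n"
        using x S(2) by auto
    qed
  qed (use \<gamma>' K' in auto)
qed

text \<open>The intervals of radius \<open>K k\<close> exhaust the line, and on each of them the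
  paths converge uniformly from stage \<open>k\<close> on. So \<open>ex_limit\<close> applies
  pointwise and the limit is continuous.\<close>

lemma ex_limit_path:
  fixes K :: "nat \<Rightarrow> real" and m :: "nat \<Rightarrow> nat"
  assumes compl: "tvs_complete V T"
    and \<gamma>: "\<And>k. continuous_map euclideanreal T (\<gamma> k)"
    and K: "-1 \<le> K 0" "\<And>k. K k + 1 \<le> K (Suc k)" and m: "\<And>k. m k < m (Suc k)"
    and step: "\<And>k t. \<bar>t\<bar> \<le> K k \<Longrightarrow> \<gamma> (Suc k) t \<ominus> \<gamma> k t \<in> B (m k + 2)"
  obtains \<eta> where "continuous_map euclideanreal T \<eta>"
    "\<And>k t. \<bar>t\<bar> \<le> K k \<Longrightarrow> \<eta> t \<ominus> \<gamma> k t \<in> B (m k)"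
proof -
  have \<gamma>V: "\<gamma> k t \<in> carrier V" for k t
    using continuous_map_carrier[OF \<gamma>] by simp
  have K_lower: "real k - 1 \<le> K k" for k
    using K by (induction k) (auto intro: order_trans[OF _ K(2)])
  have K_mono: "K i \<le> K j" if "i \<le> j" for i j
    using that by (rule lift_Suc_mono_le[rotated]) (use K(2) in \<open>smt (verit)\<close>)
  have m_lower: "k \<le> m k" for k
    using strict_mono_imp_increasing[of m k] m by (simp add: strict_mono_Suc_iff)
  have "\<exists>l. l \<in> carrier V \<and> (\<forall>k. \<bar>t\<bar> \<le> K k \<longrightarrow> l \<ominus> \<gamma> k t \<in> B (m k))" for t
  proof -
    have "\<bar>t\<bar> \<le> K (nat \<lceil>\<bar>t\<bar> + 1\<rceil>)"
      using K_lower[of "nat \<lceil>\<bar>t\<bar> + 1\<rceil>"] by linarith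
    then have *: "\<bar>t\<bar> \<le> K (LEAST k. \<bar>t\<bar> \<le> K k)"
      by (rule LeastI)
    \<comment> \<open>The first stage whose interval contains \<open>t\<close>; starting there, the
      estimates cover every \<open>k\<close> with \<open>\<bar>t\<bar> \<le> K k\<close>.\<close>
    define k\<^sub>0 where "k\<^sub>0 = (LEAST k. \<bar>t\<bar> \<le> K k)"
    have "\<bar>t\<bar> \<le> K (k\<^sub>0 + j)" for j
      using * K_mono[of k\<^sub>0 "k\<^sub>0 + j"] by (simp add: k\<^sub>0_def)
    then obtain l where l: "l \<in> carrier V" "\<And>j. l \<ominus> \<gamma> (k\<^sub>0 + j) t \<in> B (m (k\<^sub>0 + j))"
      using ex_limit[OF compl, of "\<lambda>j. \<gamma> (k\<^sub>0 + j) t" "\<lambda>j. m (k\<^sub>0 + j)"] \<gamma>V m step by auto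
    have "l \<ominus> \<gamma> k t \<in> B (m k)" if "\<bar>t\<bar> \<le> K k" for k
      using Least_le[of "\<lambda>k. \<bar>t\<bar> \<le> K k", OF that] l(2)[of "k - k\<^sub>0"] by (simp add: k\<^sub>0_def)
    then show ?thesis
      using l(1) by blast
  qed
  then obtain \<eta> where \<eta>V: "\<And>t. \<eta> t \<in> carrier V"
    and \<eta>: "\<And>k t. \<bar>t\<bar> \<le> K k \<Longrightarrow> \<eta> t \<ominus> \<gamma> k t \<in> B (m k)"
    by metis
  have "continuous_map euclideanreal T \<eta>"
  proof (rule continuous_mapI_nbhd0)
    show "\<eta> t \<in> carrier V" for t by (rule \<eta>V)
    fix t\<^sub>0 :: real and S assume "nbhd0 S"
    then obtain n where n: "B n \<subseteq> S"
      using B_base by blast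
    \<comment> \<open>A stage whose interval contains the unit ball around \<open>t\<^sub>0\<close>
      and whose precision is at least \<open>n + 2\<close>: the three differences in the continuity
      estimate cost two levels.\<close>
    define k where "k = n + 2 + nat \<lceil>\<bar>t\<^sub>0\<bar> + 2\<rceil>"
    have k: "\<bar>t\<^sub>0\<bar> + 1 \<le> K k" "n + 2 \<le> m k"
      using K_lower[of k] m_lower[of k] unfolding k_def by linarith+
    have \<eta>_near: "\<eta> t \<ominus> \<gamma> k t \<in> B (n + 2)" if "\<bar>t - t\<^sub>0\<bar> < 1" for t
    proof -
      have "\<bar>t\<bar> \<le> K k" using that k(1) by linarith
      then show ?thesis using \<eta> B_antimono[OF k(2)] by blast
    qed
    obtain W where W: "openin euclideanreal W" "t\<^sub>0 \<in> W" "\<forall>t\<in>W. \<gamma> k t \<ominus> \<gamma> k t\<^sub>0 \<in> B (n + 2)"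
      using nbhd0_continuous_map[OF B_nbhd0[of "n + 2"] \<gamma>[of k], of t\<^sub>0] by auto
    have "\<eta> t \<ominus> \<eta> t\<^sub>0 \<in> S" if "t \<in> W \<inter> ball t\<^sub>0 1" for t
    proof -
      have "\<eta> t \<ominus> \<gamma> k t \<in> B (Suc (Suc n))" "\<gamma> k t \<ominus> \<gamma> k t\<^sub>0 \<in> B (Suc (Suc n))"
        using that \<eta>_near[of t] W(3) by (auto simp: dist_real_def abs_minus_commute)
      then have "\<eta> t \<ominus> \<gamma> k t\<^sub>0 \<in> B (Suc n)"
        using B_diff_trans[of "\<eta> t" "\<gamma> k t" "\<gamma> k t\<^sub>0"] \<eta>V \<gamma>V by simp
      moreover have "\<gamma> k t\<^sub>0 \<ominus> \<eta> t\<^sub>0 \<in> B (Suc n)"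
        using \<eta>_near[of t\<^sub>0] B_diff_sym[of "\<eta> t\<^sub>0" "\<gamma> k t\<^sub>0"] B_antimono[of "Suc n" "n + 2"] \<eta>V \<gamma>V
        by auto
      ultimately have "\<eta> t \<ominus> \<eta> t\<^sub>0 \<in> B n"
        using B_diff_trans[of "\<eta> t" "\<gamma> k t\<^sub>0" "\<eta> t\<^sub>0"] \<eta>V \<gamma>V by simp
      then show ?thesis using n by blast
    qed
    moreover have "openin euclideanreal (W \<inter> ball t\<^sub>0 1)" "t\<^sub>0 \<in> W \<inter> ball t\<^sub>0 1"
      using W by auto
    ultimately show "\<exists>W. openin euclideanreal W \<and> t\<^sub>0 \<in> W \<and> (\<forall>t\<in>W. \<eta> t \<ominus> \<eta> t\<^sub>0 \<in> S)"
      by blast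
  qed
  then show thesis
    using that \<eta> by blast
qed

end

text \<open>\<open>Baire_space_branch\<close> runs with states \<open>(\<gamma>, K, m)\<close>: a
  path, the radius on which it is nearly final, and the precision. It yields one \<open>f\<close>
  with a sequence of paths whose limit \<open>\<eta>\<close> puts \<open>\<eta> \<circ> f\<close>
  into all the open sets at once.\<close>

theorem Baire_Cp_frechet:
  assumes X: "completely_regular_space X" "Hausdorff_space X"
    and Baire: "Baire_space (Cp X euclideanreal)" and frechet: "frechet_space V T"
  shows "Baire_space (Cp X T)"
proof -
  obtain B where "tvs_with_base V T B"
    using frechet_space_imp_base[OF frechet] by blast
  then interpret tvs_with_base V T B .
  have compl: "tvs_complete V T"
    using frechet by (simp add: frechet_space_def)
  show ?thesis
    unfolding Baire_space_alt
  proof (intro allI impI)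
    fix D :: "nat \<Rightarrow> ('a \<Rightarrow> 'b) set" and W
    assume D: "\<forall>n. openin (Cp X T) (D n) \<and> Cp X T closure_of D n = topspace (Cp X T)"
      and W: "openin (Cp X T) W" "W \<noteq> {}"
    \<comment> \<open>Stage 0 aims at the given open set \<open>W\<close>, stage
      \<open>Suc n\<close> at \<open>D n\<close>.\<close>
    define E where "E n = (case n of 0 \<Rightarrow> W | Suc n \<Rightarrow> D n)" for n
    have "D n \<noteq> {}" for n
      using D W openin_subset[OF W(1)] closure_of_empty[of "Cp X T"] by (metis subset_empty)
    then have E: "openin (Cp X T) (E n)" "E n \<noteq> {}" "n = 0 \<or> Cp X T closure_of E n = topspace (Cp X T)" for n
      using W D by (auto simp: E_def split: nat.split)
    \<comment> \<open>At stage 0 the radius -1 leaves no path value fixed, which allows aiming at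
      \<open>W\<close>, a set that may fail to be dense.\<close>
    define I where "I n s \<longleftrightarrow> (case s of (\<gamma>, K, m) \<Rightarrow>
        continuous_map euclideanreal T \<gamma> \<and> (n = 0 \<longrightarrow> K = -1))"
      for n :: nat and s :: "(real \<Rightarrow> 'b) \<times> real \<times> nat"
    \<comment> \<open>The last clause speaks of all paths near \<open>\<gamma>'\<close>, so it
      survives the passage to the limit path.\<close>
    define Q where "Q n s f s' \<longleftrightarrow> (case s of (\<gamma>, K, m) \<Rightarrow> case s' of (\<gamma>', K', m') \<Rightarrow>
        K + 1 \<le> K' \<and> m < m' \<and> (\<forall>t. \<bar>t\<bar> \<le> K \<longrightarrow> \<gamma>' t \<ominus>\<^bsub>V\<^esub> \<gamma> t \<in> B (m + 2)) \<and>
        (\<forall>\<eta>. continuous_map euclideanreal T \<eta> \<longrightarrow> (\<forall>t. \<bar>t\<bar> \<le> K' \<longrightarrow> \<eta> t \<ominus>\<^bsub>V\<^esub> \<gamma>' t \<in> B m') \<longrightarrow>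
          restrict (\<eta> \<circ> f) (topspace X) \<in> E n))"
      for n :: nat and s s' :: "(real \<Rightarrow> 'b) \<times> real \<times> nat" and f :: "'a \<Rightarrow> real"
    have step: "\<exists>U' s'. openin (Cp X euclideanreal) U' \<and> U' \<noteq> {} \<and> U' \<subseteq> U \<and> I (Suc n) s' \<and>
        (\<forall>f\<in>U'. Q n s f s')"
      if s: "I n s" and U: "openin (Cp X euclideanreal) U" "U \<noteq> {}" for n s U
    proof -
      obtain \<gamma> K m where s_eq: "s = (\<gamma>, K, m)"
        by (cases s) auto
      obtain f\<^sub>0 where f\<^sub>0: "f\<^sub>0 \<in> U"
        using U(2) by blast
      have dense: "K < 0 \<or> Cp X T closure_of E n = topspace (Cp X T)"
        using s E(3)[of n] by (auto simp: I_def s_eq)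
      have \<gamma>: "continuous_map euclideanreal T \<gamma>"
        using s by (simp add: I_def s_eq)
      obtain U' \<gamma>' K' m' where *: "openin (Cp X euclideanreal) U'" "U' \<noteq> {}" "U' \<subseteq> U"
        "continuous_map euclideanreal T \<gamma>'" "K + 1 \<le> K'" "m < m'"
        "\<And>t. \<bar>t\<bar> \<le> K \<Longrightarrow> \<gamma>' t \<ominus>\<^bsub>V\<^esub> \<gamma> t \<in> B (m + 2)"
        "\<And>f \<eta>. f \<in> U' \<Longrightarrow> continuous_map euclideanreal T \<eta> \<Longrightarrow>
          (\<And>t. \<bar>t\<bar> \<le> K' \<Longrightarrow> \<eta> t \<ominus>\<^bsub>V\<^esub> \<gamma>' t \<in> B m') \<Longrightarrow> restrict (\<eta> \<circ> f) (topspace X) \<in> E n"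
        by (rule approximate_by_path[OF X U(1) f\<^sub>0 E(1,2) dense \<gamma>, of m]) blast
      have "I (Suc n) (\<gamma>', K', m')"
        using *(4) by (simp add: I_def)
      moreover have "Q n s f (\<gamma>', K', m')" if "f \<in> U'" for f
        unfolding Q_def s_eq using *(5-7) *(8)[OF that] by simp
      ultimately show ?thesis
        using *(1-3) by blast
    qed
    have ne: "topspace (Cp X euclideanreal) \<noteq> {}"
      using restrict_in_Cp[of X euclideanreal "\<lambda>_. 0"] by auto
    have "I 0 (\<lambda>_. \<zero>\<^bsub>V\<^esub>, -1, 0)"
      by (simp add: I_def)
    then obtain f \<sigma> where \<sigma>: "f \<in> topspace (Cp X euclideanreal)" "\<sigma> 0 = (\<lambda>_. \<zero>\<^bsub>V\<^esub>, -1, 0)"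
      "\<And>n. I n (\<sigma> n)" "\<And>n. Q n (\<sigma> n) f (\<sigma> (Suc n))"
      by (rule Baire_space_branch[where I = I and Q = Q, OF Baire ne]) (erule (2) step, blast)
    define \<gamma> where "\<gamma> n = fst (\<sigma> n)" for n
    define K where "K n = fst (snd (\<sigma> n))" for n
    define m where "m n = snd (snd (\<sigma> n))" for n
    have \<sigma>_eq: "\<sigma> n = (\<gamma> n, K n, m n)" for n
      by (simp add: \<gamma>_def K_def m_def)
    have Q: "K n + 1 \<le> K (Suc n)" "m n < m (Suc n)"
      "\<And>t. \<bar>t\<bar> \<le> K n \<Longrightarrow> \<gamma> (Suc n) t \<ominus>\<^bsub>V\<^esub> \<gamma> n t \<in> B (m n + 2)"
      "\<And>\<eta>. continuous_map euclideanreal T \<eta> \<Longrightarrow>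
        (\<And>t. \<bar>t\<bar> \<le> K (Suc n) \<Longrightarrow> \<eta> t \<ominus>\<^bsub>V\<^esub> \<gamma> (Suc n) t \<in> B (m (Suc n))) \<Longrightarrow>
        restrict (\<eta> \<circ> f) (topspace X) \<in> E n" for n
      using \<sigma>(4)[of n] by (auto simp: Q_def \<sigma>_eq)
    have "continuous_map euclideanreal T (\<gamma> n)" for n
      using \<sigma>(3)[of n] by (simp add: I_def \<sigma>_eq)
    moreover have "-1 \<le> K 0"
      using \<sigma>(2) by (simp add: K_def)
    ultimately obtain \<eta> where "continuous_map euclideanreal T \<eta>"
      "\<And>k t. \<bar>t\<bar> \<le> K k \<Longrightarrow> \<eta> t \<ominus>\<^bsub>V\<^esub> \<gamma> k t \<in> B (m k)"
      using ex_limit_path[OF compl, of \<gamma> K m] Q(1-3) by blast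
    \<comment> \<open>The limit satisfies the closeness condition of every stage.\<close>
    then have "restrict (\<eta> \<circ> f) (topspace X) \<in> E n" for n
      using Q(4) by blast
    from this[of 0] this[of "Suc _"] show "\<exists>x\<in>W. \<forall>n. x \<in> D n"
      by (auto simp: E_def)
  qed
qed

section \<open>A continuous real function that is equivariant under translation along a
  vector\<close>

context real_topological_vector_space
begin

text \<open>
  \<open>r x\<close> is the Busemann function \<open>lim (p (x + t e) - t)\<close>, \<open>t \<rightarrow> \<infinity>\<close>, of the gauge \<open>p\<close> of a convex
  symmetric neighbourhood \<open>C\<close> of the origin with \<open>e \<notin> C\<close>; it replaces a Hahn-Banach functional
  with value 1 at \<open>e\<close>.
\<close>

lemma ex_translation_equivariant_map:
  assumes lc: "locally_convex V T" and "Hausdorff_space T" and e: "e \<in> carrier V" "e \<noteq> \<zero>"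
  obtains r where "continuous_map T euclideanreal r"
    "\<And>x u. x \<in> carrier V \<Longrightarrow> r (x \<oplus> u \<odot> e) = r x + u"
proof -
  obtain O\<^sub>0 where "openin T O\<^sub>0" "\<zero> \<in> O\<^sub>0" "e \<notin> O\<^sub>0"
    using \<open>Hausdorff_space T\<close> e unfolding Hausdorff_space_def disjnt_iff
    by (metis M.zero_closed topspace_T)
  then have nb: "nbhd0 (carrier V - {e})"
    unfolding nbhd0_def by (metis Diff_empty openin_subset subset_Diff_insert topspace_T)
  obtain C where C: "C \<subseteq> carrier V" "convex_in V C" "nbhd0 C" "\<And>x. x \<in> C \<Longrightarrow> \<ominus> x \<in> C"
    and sum_C: "\<And>x y. x \<in> C \<Longrightarrow> y \<in> C \<Longrightarrow> x \<oplus> y \<in> carrier V - {e}"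
    using ex_small_convex[OF lc nb] by blast
  have C0: "\<zero> \<in> C"
    using C(3) by (rule nbhd0_zero)
  have eC: "e \<notin> C"
    using sum_C[OF _ C0, of e] e by auto

  \<comment> \<open>\<open>x\<close> lies in \<open>s C\<close>, with \<open>s\<close> positive; the
    gauge of \<open>C\<close> at \<open>x\<close> is the infimum of such \<open>s\<close>. The next
    fact is its subadditivity: the rescaled sum is a convex combination.\<close>
  define mem where "mem s x \<longleftrightarrow> 0 < s \<and> (1 / s) \<odot> x \<in> C" for s x
  have mem_add: "mem (s + s') (x \<oplus> y)" if "mem s x" "mem s' y" "x \<in> carrier V" "y \<in> carrier V" for s s' x y
  proof -
    define t where "t = s' / (s + s')"
    have s: "0 < s" "0 < s'"
      using that by (auto simp: mem_def)
    then have t: "0 \<le> t" "t \<le> 1" "(1 - t) * (1 / s) = 1 / (s + s')" "t * (1 / s') = 1 / (s + s')"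
      by (auto simp: t_def field_simps)
    have "(1 - t) \<odot> ((1 / s) \<odot> x) \<oplus> t \<odot> ((1 / s') \<odot> y) \<in> C"
      using C(2) that(1,2) t(1,2) by (auto simp: convex_in_def mem_def)
    then have "(1 / (s + s')) \<odot> x \<oplus> (1 / (s + s')) \<odot> y \<in> C"
      using that(3,4) t(3,4) by (simp add: scale_scale)
    then show ?thesis
      using that(3,4) s by (simp add: mem_def scale_add_right)
  qed
  \<comment> \<open>If \<open>t \<ge> s\<close>, then shrinking by \<open>s / t\<close> would put
    \<open>e\<close> itself into \<open>C\<close>.\<close>
  have mem_e: "t < s" if "mem s (t \<odot> e)" for s t
  proof (rule ccontr)
    assume "\<not> t < s"
    then have "(s / t) \<odot> ((1 / s) \<odot> (t \<odot> e)) \<in> C"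
      using that convex_scale[OF C(2,1) C0, of "(1 / s) \<odot> (t \<odot> e)" "s / t"] by (simp add: mem_def)
    then show False
      using eC e that \<open>\<not> t < s\<close> by (auto simp: mem_def scale_scale)
  qed
  have mem_minus: "mem s (\<ominus> x)" if "mem s x" "x \<in> carrier V" for s x
    using that C(4) by (auto simp: mem_def scale_minus_right)
  have absorb: "\<exists>s. mem s x" if x: "x \<in> carrier V" for x
  proof -
    have "continuous_map euclideanreal T (\<lambda>a. a \<odot> x)"
      using x by (intro continuous_map_scale_tvs) auto
    then obtain W where W: "open W" "0 \<in> W" "\<forall>a\<in>W. a \<odot> x \<in> C"
      using nbhd0_preimage[OF C(3), of euclideanreal "\<lambda>a. a \<odot> x" 0] x by auto
    then obtain \<delta> where \<delta>: "\<delta> > 0" "ball 0 \<delta> \<subseteq> W"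
      using open_contains_ball by blast
    then have "\<delta> / 2 \<in> W" by auto
    then show ?thesis
      using W(3) \<delta>(1) by (intro exI[of _ "2 / \<delta>"]) (auto simp: mem_def)
  qed

  \<comment> \<open>The infimum of \<open>A x\<close> is that of \<open>p (x + t e) - t\<close> over
    all real \<open>t\<close>, with \<open>p\<close> the gauge; the shift rule for \<open>r\<close>
    is then the substitution of \<open>t - u\<close> for \<open>t\<close>.\<close>
  define A where "A x = {s - t |s t. mem s (x \<oplus> t \<odot> e)}" for x
  define r where "r x = Inf (A x)" for x
  have A_mem: "s - t \<in> A x" if "mem s (x \<oplus> t \<odot> e)" for s t x
    unfolding A_def using that by (intro CollectI exI conjI) (rule refl)
  have A_ne: "A x \<noteq> {}" if x: "x \<in> carrier V" for x
  proof -
    obtain s where "mem s (x \<oplus> 0 \<odot> e)"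
      using absorb[of "x \<oplus> 0 \<odot> e"] x e(1) by auto
    then show ?thesis
      using A_mem by blast
  qed
  have A_bdd: "bdd_below (A x)" if x: "x \<in> carrier V" for x
  proof -
    obtain s' where s': "mem s' x"
      using absorb[OF x] by blast
    have "- s' \<le> s - t" if "mem s (x \<oplus> t \<odot> e)" for s t
    proof -
      \<comment> \<open>Removing \<open>x\<close> leaves \<open>t e\<close>, whose gauge bounds
        \<open>t\<close> by \<open>s + s'\<close>.\<close>
      have "mem (s + s') ((x \<oplus> t \<odot> e) \<oplus> \<ominus> x)"
        using that mem_minus[OF s' x] x e by (intro mem_add) auto
      moreover have "(x \<oplus> t \<odot> e) \<oplus> \<ominus> x = t \<odot> e"
        using add_diff_cancel[of x "t \<odot> e"] x e by (simp add: a_minus_def)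
      ultimately show ?thesis
        using mem_e[of "s + s'" t] by simp
    qed
    then show ?thesis
      unfolding bdd_below_def A_def by blast
  qed
  \<comment> \<open>In gauge terms \<open>r (x + y) \<le> r x + p y\<close>; applied in both
    directions, this gives continuity below.\<close>
  have r_add_le: "r (x \<oplus> y) \<le> r x + s'" if x: "x \<in> carrier V" "y \<in> carrier V" and s': "mem s' y" for x y s'
  proof -
    have "r (x \<oplus> y) - s' \<le> a" if a: "a \<in> A x" for a
    proof -
      obtain s t where st: "a = s - t" "mem s (x \<oplus> t \<odot> e)"
        using a by (auto simp: A_def)
      have "(x \<oplus> t \<odot> e) \<oplus> y = (x \<oplus> y) \<oplus> t \<odot> e"
        using x e by (simp add: M.a_ac)
      then have "mem (s + s') ((x \<oplus> y) \<oplus> t \<odot> e)"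
        using mem_add[OF st(2) s'] x e by simp
      then have "(s + s') - t \<in> A (x \<oplus> y)"
        by (rule A_mem)
      then have "r (x \<oplus> y) \<le> (s + s') - t"
        unfolding r_def using A_bdd x by (intro cInf_lower) auto
      then show ?thesis
        using st(1) by simp
    qed
    then have "r (x \<oplus> y) - s' \<le> r x"
      unfolding r_def[of x] using A_ne x by (intro cInf_greatest) auto
    then show ?thesis by simp
  qed
  have r_shift_le: "r (x \<oplus> u \<odot> e) \<le> r x + u" if x: "x \<in> carrier V" for x u
  proof -
    have "r (x \<oplus> u \<odot> e) - u \<le> a" if a: "a \<in> A x" for a
    proof -
      obtain s t where st: "a = s - t" "mem s (x \<oplus> t \<odot> e)"
        using a by (auto simp: A_def)
      have "(x \<oplus> u \<odot> e) \<oplus> (t - u) \<odot> e = x \<oplus> t \<odot> e"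
        using x e scale_add_left[of e u "t - u"] by (simp add: M.a_assoc)
      then have "s - (t - u) \<in> A (x \<oplus> u \<odot> e)"
        using A_mem[of s "x \<oplus> u \<odot> e" "t - u"] st(2) by simp
      then have "r (x \<oplus> u \<odot> e) \<le> s - (t - u)"
        unfolding r_def using A_bdd x e by (intro cInf_lower) auto
      then show ?thesis
        using st(1) by simp
    qed
    then have "r (x \<oplus> u \<odot> e) - u \<le> r x"
      unfolding r_def[of x] using A_ne x by (intro cInf_greatest) auto
    then show ?thesis by simp
  qed
  show thesis
  proof
    show "r (x \<oplus> u \<odot> e) = r x + u" if x: "x \<in> carrier V" for x u
    proof (rule antisym[OF r_shift_le[OF x]])
      \<comment> \<open>Shifting back by \<open>- u\<close> turns the one inequality into its
        converse.\<close>
      have "(x \<oplus> u \<odot> e) \<oplus> (- u) \<odot> e = x"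
        using x e scale_add_left[of e u "- u"] by (simp add: M.a_assoc)
      then show "r x + u \<le> r (x \<oplus> u \<odot> e)"
        using r_shift_le[of "x \<oplus> u \<odot> e" "- u"] x e by simp
    qed
    have "\<exists>U. openin T U \<and> x \<in> U \<and> (\<forall>y\<in>U. r y \<in> ball (r x) \<epsilon>)"
      if x: "x \<in> topspace T" and \<epsilon>: "\<epsilon> > 0" for x \<epsilon>
    proof -
      have xV: "x \<in> carrier V" using x by simp
      have "continuous_map T T (\<lambda>y. (2 / \<epsilon>) \<odot> (y \<ominus> x))"
        using xV by (intro continuous_map_scale_tvs continuous_map_diff_tvs) auto
      then obtain W where W: "openin T W" "x \<in> W" "\<And>y. y \<in> W \<Longrightarrow> (2 / \<epsilon>) \<odot> (y \<ominus> x) \<in> C"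
        using nbhd0_preimage[OF C(3) _ x, of "\<lambda>y. (2 / \<epsilon>) \<odot> (y \<ominus> x)"] xV by auto
      have "r y \<in> ball (r x) \<epsilon>" if y: "y \<in> W" for y
      proof -
        have yV: "y \<in> carrier V"
          using y openin_subset[OF W(1)] by auto
        have m: "mem (\<epsilon> / 2) (y \<ominus> x)"
          using W(3)[OF y] \<epsilon> by (simp add: mem_def)
        then have m': "mem (\<epsilon> / 2) (x \<ominus> y)"
          using mem_minus[OF m] xV yV by (simp add: minus_diff)
        have "x \<oplus> (y \<ominus> x) = y" "y \<oplus> (x \<ominus> y) = x"
          using xV yV M.a_comm diff_add_cancel M.minus_closed by metis+
        then have "r y \<le> r x + \<epsilon> / 2" "r x \<le> r y + \<epsilon> / 2"
          using r_add_le[OF xV _ m] r_add_le[OF yV _ m'] xV yV by simp_all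
        then show ?thesis
          using \<epsilon> by (simp add: dist_real_def)
      qed
      then show ?thesis
        using W(1,2) by blast
    qed
    then show "continuous_map T euclideanreal r"
      by (simp add: Met_TC.continuous_map_to_metric flip: mtopology_is_euclidean)
  qed
qed

end

subsection \<open>From vector-valued functions to real functions\<close>

text \<open>A zero basis vector would give the zero vector two expansions, one with all coefficients
  0 and one with coefficient 1 at that vector.\<close>

lemma positive_dim_imp_nonzero:
  assumes "module real_field V" "positive_dim V"
  obtains e where "e \<in> carrier V" "e \<noteq> \<zero>\<^bsub>V\<^esub>"
proof -
  interpret module real_field V by fact
  obtain S b where S: "hamel_basis V S" "b \<in> S"
    using assms(2) by (auto simp: positive_dim_def)
  then have b: "b \<in> carrier V"
    by (auto simp: hamel_basis_def)
  define expands where "expands c \<longleftrightarrow> finite {b. c b \<noteq> 0} \<and> {b. c b \<noteq> 0} \<subseteq> S \<and>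
      \<zero>\<^bsub>V\<^esub> = finsum V (\<lambda>b. c b \<odot>\<^bsub>V\<^esub> b) {b. c b \<noteq> 0}" for c :: "'a \<Rightarrow> real"
  have uniq: "\<exists>!c. expands c"
    using S(1) unfolding hamel_basis_def expands_def by auto
  have "b \<noteq> \<zero>\<^bsub>V\<^esub>"
  proof
    assume b0: "b = \<zero>\<^bsub>V\<^esub>"
    have "expands (\<lambda>_. 0)"
      by (simp add: expands_def)
    moreover have "expands (\<lambda>x. if x = b then 1 else 0)"
    proof -
      have "1 \<odot>\<^bsub>V\<^esub> b = b"
        using smult_one[OF b] by (simp add: ring_of_type_algebra_def)
      then show ?thesis
        using S(2) b b0 by (simp add: expands_def)
    qed
    ultimately have "(\<lambda>_. 0 :: real) = (\<lambda>x. if x = b then 1 else 0)"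
      using uniq by blast
    then show False
      by (metis zero_neq_one)
  qed
  then show thesis
    using that b by blast
qed

theorem Baire_Cp_real:
  assumes frechet: "frechet_space V T" and "positive_dim V" and Baire: "Baire_space (Cp X T)"
  shows "Baire_space (Cp X euclideanreal)"
proof -
  interpret real_topological_vector_space V T
    using frechet by unfold_locales (simp add: frechet_space_def)
  obtain e where e: "e \<in> carrier V" "e \<noteq> \<zero>\<^bsub>V\<^esub>"
    using positive_dim_imp_nonzero[OF module_axioms assms(2)] by blast
  have "locally_convex V T" "Hausdorff_space T"
    using frechet metrizable_imp_Hausdorff_space by (auto simp: frechet_space_def)
  then obtain r where r: "continuous_map T euclideanreal r"
    "\<And>x u. x \<in> carrier V \<Longrightarrow> r (x \<oplus>\<^bsub>V\<^esub> u \<odot>\<^bsub>V\<^esub> e) = r x + u"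
    using ex_translation_equivariant_map[OF _ _ e] by metis
  define \<phi> where "\<phi> f = restrict (r \<circ> f) (topspace X)" for f
  have \<phi>: "\<phi> f \<in> topspace (Cp X euclideanreal)" if "f \<in> topspace (Cp X T)" for f
    unfolding \<phi>_def using that r(1) by (intro restrict_in_Cp continuous_map_compose[of X T]) (auto simp: topspace_Cp)
  define \<sigma> where "\<sigma> f g = (\<lambda>x\<in>topspace X. f x \<oplus>\<^bsub>V\<^esub> (g x - r (f x)) \<odot>\<^bsub>V\<^esub> e)" for f g
  have sec: "continuous_map (Cp X euclideanreal) (Cp X T) (\<sigma> f) \<and> \<sigma> f (\<phi> f) = f \<and>
      (\<forall>g\<in>topspace (Cp X euclideanreal). \<phi> (\<sigma> f g) = g)" if f: "f \<in> topspace (Cp X T)" for f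
  proof (intro conjI ballI)
    have fc: "continuous_map X T f" "f \<in> extensional (topspace X)"
      using f by (auto simp: topspace_Cp)
    then have rf: "continuous_map X euclideanreal (\<lambda>x. r (f x))"
      using continuous_map_compose[OF fc(1) r(1)] by (simp add: o_def)
    have fV: "f x \<in> carrier V" if "x \<in> topspace X" for x
      using continuous_map_carrier[OF fc(1) that] .
    show "continuous_map (Cp X euclideanreal) (Cp X T) (\<sigma> f)"
    proof (rule continuous_map_into_Cp)
      fix g assume "g \<in> topspace (Cp X euclideanreal)"
      then have "continuous_map X euclideanreal g"
        by (simp add: topspace_Cp)
      then show "\<sigma> f g \<in> topspace (Cp X T)"
        unfolding \<sigma>_def using fc(1) rf e(1)
        by (intro restrict_in_Cp continuous_map_add_tvs continuous_map_scale_tvs continuous_map_diff) auto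
    next
      fix x assume x: "x \<in> topspace X"
      then have "continuous_map (Cp X euclideanreal) T (\<lambda>g. f x \<oplus>\<^bsub>V\<^esub> (g x - r (f x)) \<odot>\<^bsub>V\<^esub> e)"
        using fV[OF x] e(1)
        by (intro continuous_map_add_tvs continuous_map_scale_tvs continuous_map_diff continuous_map_Cp_eval) auto
      then show "continuous_map (Cp X euclideanreal) T (\<lambda>g. \<sigma> f g x)"
        using x by (simp add: \<sigma>_def)
    qed
    show "\<sigma> f (\<phi> f) = f"
      using fc(2) fV e(1) by (intro extensionalityI[of _ "topspace X"]) (auto simp: \<sigma>_def \<phi>_def)
    show "\<phi> (\<sigma> f g) = g" if "g \<in> topspace (Cp X euclideanreal)" for g
      using that fV r(2) by (intro extensionalityI[of _ "topspace X"]) (auto simp: \<sigma>_def \<phi>_def topspace_Cp)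
  qed
  \<comment> \<open>The section through the zero function shows that \<open>\<phi>\<close> is
    onto.\<close>
  have zero: "restrict (\<lambda>_. \<zero>\<^bsub>V\<^esub>) (topspace X) \<in> topspace (Cp X T)"
    by (intro restrict_in_Cp) simp
  show ?thesis
  proof (rule Baire_space_open_surjection[OF Baire])
    show "continuous_map (Cp X T) (Cp X euclideanreal) \<phi>"
    proof (rule continuous_map_into_Cp[OF \<phi>])
      fix x assume x: "x \<in> topspace X"
      then show "continuous_map (Cp X T) euclideanreal (\<lambda>f. \<phi> f x)"
        using continuous_map_compose[OF continuous_map_Cp_eval[OF x] r(1)] by (simp add: \<phi>_def o_def)
    qed
    show "open_map (Cp X T) (Cp X euclideanreal) \<phi>"
      by (rule open_map_sections) (use sec \<phi> in blast)+
    show "\<phi> ` topspace (Cp X T) = topspace (Cp X euclideanreal)"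
    proof
      show "\<phi> ` topspace (Cp X T) \<subseteq> topspace (Cp X euclideanreal)"
        using \<phi> by blast
      show "topspace (Cp X euclideanreal) \<subseteq> \<phi> ` topspace (Cp X T)"
      proof
        fix g assume g: "g \<in> topspace (Cp X euclideanreal)"
        define f where "f = \<sigma> (restrict (\<lambda>_. \<zero>\<^bsub>V\<^esub>) (topspace X)) g"
        have "f \<in> topspace (Cp X T)"
          using sec[OF zero] g continuous_map_image_subset_topspace unfolding f_def by blast
        moreover have "\<phi> f = g"
          using sec[OF zero] g by (simp add: f_def)
        ultimately show "g \<in> \<phi> ` topspace (Cp X T)"
          by blast
      qed
    qed
  qed
qed

subsection \<open>The real line on an arbitrary large type\<close>

text \<open>The real line transported along an injection: a nonzero Frechet space on a prescribed
  type, as the quantifiers over \<open>M\<close> and \<open>L\<close> demand.\<close>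

definition real_copy :: "(real \<Rightarrow> 'm) \<Rightarrow> (real, 'm) module"
  where "real_copy \<phi> = \<lparr>carrier = range \<phi>, monoid.mult = \<lambda>x y. undefined, one = undefined,
    zero = \<phi> 0, add = \<lambda>x y. \<phi> (the_inv \<phi> x + the_inv \<phi> y), smult = \<lambda>r x. \<phi> (r * the_inv \<phi> x)\<rparr>"

definition real_copy_topology :: "(real \<Rightarrow> 'm) \<Rightarrow> 'm topology"
  where "real_copy_topology \<phi> = pullback_topology (range \<phi>) (the_inv \<phi>) euclideanreal"

context
  fixes \<phi> :: "real \<Rightarrow> 'm"
  assumes \<phi>: "inj \<phi>"
begin

lemma real_copy_simps [simp]:
  "carrier (real_copy \<phi>) = range \<phi>" "\<zero>\<^bsub>real_copy \<phi>\<^esub> = \<phi> 0"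
  "x \<oplus>\<^bsub>real_copy \<phi>\<^esub> y = \<phi> (the_inv \<phi> x + the_inv \<phi> y)"
  "r \<odot>\<^bsub>real_copy \<phi>\<^esub> x = \<phi> (r * the_inv \<phi> x)"
  by (simp_all add: real_copy_def)

lemma the_inv_real_copy [simp]: "the_inv \<phi> (\<phi> a) = a"
  using \<phi> by (rule the_inv_f_f)

lemma module_real_copy: "module real_field (real_copy \<phi>)"
proof (rule moduleI)
  show "cring (real_field :: real ring)"
    by (rule cring_from_type_algebra)
  show "abelian_group (real_copy \<phi>)"
  proof (rule abelian_groupI)
    fix x assume "x \<in> carrier (real_copy \<phi>)"
    then show "\<exists>y\<in>carrier (real_copy \<phi>). y \<oplus>\<^bsub>real_copy \<phi>\<^esub> x = \<zero>\<^bsub>real_copy \<phi>\<^esub>"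
      by (intro bexI[of _ "\<phi> (- the_inv \<phi> x)"]) auto
  qed (auto simp: algebra_simps)
qed (auto simp: algebra_simps ring_of_type_algebra_def)

lemma homeomorphic_maps_real_copy:
  "homeomorphic_maps euclideanreal (real_copy_topology \<phi>) \<phi> (the_inv \<phi>)"
proof -
  have "continuous_map (real_copy_topology \<phi>) euclideanreal (id \<circ> the_inv \<phi>)"
    unfolding real_copy_topology_def by (intro continuous_map_pullback) simp
  moreover have "continuous_map euclideanreal (real_copy_topology \<phi>) \<phi>"
    unfolding real_copy_topology_def by (intro continuous_map_pullback') (auto simp: o_def)
  ultimately show ?thesis
    by (auto simp: homeomorphic_maps_def real_copy_topology_def topspace_pullback_topology)
qed

lemma topspace_real_copy [simp]: "topspace (real_copy_topology \<phi>) = range \<phi>"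
  by (auto simp: real_copy_topology_def topspace_pullback_topology)

lemma real_tvs_real_copy: "real_tvs (real_copy \<phi>) (real_copy_topology \<phi>)"
proof -
  let ?T = "real_copy_topology \<phi>"
  have \<phi>c: "continuous_map euclideanreal ?T \<phi>" and ic: "continuous_map ?T euclideanreal (the_inv \<phi>)"
    using homeomorphic_maps_real_copy by (auto simp: homeomorphic_maps_def)
  have "continuous_map (prod_topology ?T ?T) ?T (\<phi> \<circ> (\<lambda>z. the_inv \<phi> (fst z) + the_inv \<phi> (snd z)))"
    using continuous_map_compose[OF continuous_map_fst ic] continuous_map_compose[OF continuous_map_snd ic]
    by (intro continuous_map_compose[OF _ \<phi>c] continuous_map_add) (simp_all add: o_def)
  moreover have "continuous_map (prod_topology euclideanreal ?T) ?T (\<phi> \<circ> (\<lambda>z. fst z * the_inv \<phi> (snd z)))"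
    using continuous_map_compose[OF continuous_map_snd ic]
    by (intro continuous_map_compose[OF _ \<phi>c] continuous_map_real_mult continuous_map_fst) (simp_all add: o_def)
  ultimately show ?thesis
    using module_real_copy by (simp add: real_tvs_def case_prod_unfold o_def)
qed

interpretation real_topological_vector_space "real_copy \<phi>" "real_copy_topology \<phi>"
  by unfold_locales (rule real_tvs_real_copy)

text \<open>Subtraction uses the abstract group inverse; writing it as scaling by -1 makes it
  computable.\<close>

lemma real_copy_diff: "\<phi> a \<ominus>\<^bsub>real_copy \<phi>\<^esub> \<phi> b = \<phi> (a - b)"
  using scale_minus_one[of "\<phi> b"] by (simp add: a_minus_def flip: scale_minus_one)

lemma openin_real_copy: "openin (real_copy_topology \<phi>) U \<Longrightarrow> open {a. \<phi> a \<in> U}"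
  using homeomorphic_maps_real_copy openin_continuous_map_preimage[of euclideanreal _ \<phi> U]
  by (auto simp: homeomorphic_maps_def)

text \<open>Images of balls around 0 are a convex base at the origin. A Cauchy filter is mapped to a
  real Cauchy filter, whose limit is carried back by \<open>\<phi>\<close>; metrizability passes
  along the homeomorphism.\<close>

lemma frechet_space_real_copy: "frechet_space (real_copy \<phi>) (real_copy_topology \<phi>)"
proof -
  have hom: "homeomorphic_map euclideanreal (real_copy_topology \<phi>) \<phi>"
    using homeomorphic_maps_real_copy homeomorphic_maps_map by blast
  have ball: "\<exists>\<epsilon>>0. \<phi> ` ball a \<epsilon> \<subseteq> U" if "openin (real_copy_topology \<phi>) U" "\<phi> a \<in> U" for U a
    using openin_real_copy[OF that(1)] that(2) by (force simp: open_contains_ball)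
  have "locally_convex (real_copy \<phi>) (real_copy_topology \<phi>)"
    unfolding locally_convex_def neighbourhood_base_at_def
  proof (intro allI impI)
    fix W assume "openin (real_copy_topology \<phi>) W \<and> \<zero>\<^bsub>real_copy \<phi>\<^esub> \<in> W"
    then obtain \<epsilon> where \<epsilon>: "\<epsilon> > 0" "\<phi> ` ball 0 \<epsilon> \<subseteq> W"
      using ball[of W 0] by auto
    have "openin (real_copy_topology \<phi>) (\<phi> ` ball 0 \<epsilon>)"
      using homeomorphic_imp_open_map[OF hom] by (simp add: open_map_def)
    moreover have "convex_in (real_copy \<phi>) (\<phi> ` ball 0 \<epsilon>)"
    proof -
      have "(1 - t) * a + t * b \<in> ball 0 \<epsilon>" if "a \<in> ball 0 \<epsilon>" "b \<in> ball 0 \<epsilon>" "t \<in> {0..1}" for a b t :: real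
        using that convex_ball[of "0::real" \<epsilon>] unfolding convex_alt by auto
      then show ?thesis
        unfolding convex_in_def by (auto simp del: mem_ball)
    qed
    ultimately show "\<exists>U V. openin (real_copy_topology \<phi>) U \<and> convex_in (real_copy \<phi>) V \<and>
        \<zero>\<^bsub>real_copy \<phi>\<^esub> \<in> U \<and> U \<subseteq> V \<and> V \<subseteq> W"
      using \<epsilon> by (intro exI[of _ "\<phi> ` ball 0 \<epsilon>"]) auto
  qed
  moreover have "tvs_complete (real_copy \<phi>) (real_copy_topology \<phi>)"
    unfolding tvs_complete_def
  proof (intro allI impI)
    fix F assume F: "tvs_cauchy_filter (real_copy \<phi>) (real_copy_topology \<phi>) F"
    then have F_car: "\<forall>\<^sub>F x in F. x \<in> range \<phi>" and "F \<noteq> bot"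
      by (auto simp: tvs_cauchy_filter_def)
    have "cauchy_filter (filtermap (the_inv \<phi>) F)"
      unfolding cauchy_filter_metric_filtermap
    proof (intro allI impI)
      fix \<epsilon> :: real assume "\<epsilon> > 0"
      then have "openin (real_copy_topology \<phi>) (\<phi> ` ball 0 \<epsilon>)" "\<zero>\<^bsub>real_copy \<phi>\<^esub> \<in> \<phi> ` ball 0 \<epsilon>"
        using homeomorphic_imp_open_map[OF hom] by (auto simp: open_map_def)
      then obtain A where A: "A \<subseteq> range \<phi>" "\<forall>\<^sub>F x in F. x \<in> A"
        and diff: "\<forall>x\<in>A. \<forall>y\<in>A. x \<ominus>\<^bsub>real_copy \<phi>\<^esub> y \<in> \<phi> ` ball 0 \<epsilon>"
        using F unfolding tvs_cauchy_filter_def real_copy_simps by meson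
      have "dist (the_inv \<phi> x) (the_inv \<phi> y) < \<epsilon>" if xy: "x \<in> A" "y \<in> A" for x y
      proof -
        obtain a b where "x = \<phi> a" "y = \<phi> b"
          using xy A(1) by blast
        then have "\<phi> (a - b) \<in> \<phi> ` ball 0 \<epsilon>"
          using diff xy real_copy_diff[of a b] by metis
        then show ?thesis
          using \<open>x = \<phi> a\<close> \<open>y = \<phi> b\<close> \<phi> by (simp add: inj_image_mem_iff dist_real_def)
      qed
      then show "\<exists>P. eventually P F \<and> (\<forall>x y. P x \<and> P y \<longrightarrow> dist (the_inv \<phi> x) (the_inv \<phi> y) < \<epsilon>)"
        using A(2) by (intro exI[of _ "\<lambda>x. x \<in> A"]) auto
    qed
    then obtain l where l: "filtermap (the_inv \<phi>) F \<le> nhds l"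
      using cauchy_filter_complete_converges[of "filtermap (the_inv \<phi>) F" UNIV] complete_UNIV \<open>F \<noteq> bot\<close>
      by (auto simp: filtermap_bot_iff)
    have "limitin (real_copy_topology \<phi>) (\<lambda>x. x) (\<phi> l) F"
      unfolding limitin_def
    proof (intro conjI allI impI)
      fix U assume U: "openin (real_copy_topology \<phi>) U \<and> \<phi> l \<in> U"
      then have "\<forall>\<^sub>F a in nhds l. \<phi> a \<in> U"
        using openin_real_copy[of U] eventually_nhds_in_open[of "{a. \<phi> a \<in> U}" l] by auto
      \<comment> \<open>The filter lives on the range of \<open>\<phi>\<close>, where
        \<open>\<phi>\<close> undoes its inverse.\<close>
      then have "\<forall>\<^sub>F x in F. \<phi> (the_inv \<phi> x) \<in> U"
        using l unfolding le_filter_def eventually_filtermap by blast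
      then show "\<forall>\<^sub>F x in F. x \<in> U"
        using F_car by eventually_elim auto
    qed simp
    then show "\<exists>l. limitin (real_copy_topology \<phi>) (\<lambda>x. x) l F"
      by blast
  qed
  moreover have "metrizable_space (real_copy_topology \<phi>)"
    using homeomorphic_metrizable_space[OF homeomorphic_map_imp_homeomorphic_space[OF hom]]
      metrizable_space_euclidean by blast
  ultimately show ?thesis
    by (simp add: frechet_space_def real_tvs_real_copy)
qed

text \<open>The basis is \<open>{\<phi> 1}\<close>: a coefficient function supported there is
  determined by its value at \<open>\<phi> 1\<close>, which the sum recovers.\<close>

lemma positive_dim_real_copy: "positive_dim (real_copy \<phi>)"
proof -
  have single: "finsum (real_copy \<phi>) (\<lambda>b. c b \<odot>\<^bsub>real_copy \<phi>\<^esub> b) {b. c b \<noteq> 0} = \<phi> (c (\<phi> 1))"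
    if "{b. c b \<noteq> 0} \<subseteq> {\<phi> 1}" for c
  proof (cases "c (\<phi> 1) = 0")
    case True
    then have "{b. c b \<noteq> 0} = {}" using that by auto
    then show ?thesis using True by simp
  next
    case False
    then have "{b. c b \<noteq> 0} = {\<phi> 1}" using that by auto
    then show ?thesis by simp
  qed
  have "\<exists>!c. finite {b. c b \<noteq> 0} \<and> {b. c b \<noteq> 0} \<subseteq> {\<phi> 1} \<and>
      x = finsum (real_copy \<phi>) (\<lambda>b. c b \<odot>\<^bsub>real_copy \<phi>\<^esub> b) {b. c b \<noteq> 0}" if x: "x \<in> range \<phi>" for x
  proof (rule ex1I[of _ "\<lambda>b. if b = \<phi> 1 then the_inv \<phi> x else 0"])
    have *: "{b. (if b = \<phi> 1 then the_inv \<phi> x else 0) \<noteq> 0} \<subseteq> {\<phi> 1}"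
      by auto
    then show "finite {b. (if b = \<phi> 1 then the_inv \<phi> x else 0) \<noteq> 0} \<and>
        {b. (if b = \<phi> 1 then the_inv \<phi> x else 0) \<noteq> 0} \<subseteq> {\<phi> 1} \<and>
        x = finsum (real_copy \<phi>) (\<lambda>b. (if b = \<phi> 1 then the_inv \<phi> x else 0) \<odot>\<^bsub>real_copy \<phi>\<^esub> b)
          {b. (if b = \<phi> 1 then the_inv \<phi> x else 0) \<noteq> 0}"
      using single[OF *] x finite_subset[OF *] by auto
    fix c assume c: "finite {b. c b \<noteq> 0} \<and> {b. c b \<noteq> 0} \<subseteq> {\<phi> 1} \<and>
      x = finsum (real_copy \<phi>) (\<lambda>b. c b \<odot>\<^bsub>real_copy \<phi>\<^esub> b) {b. c b \<noteq> 0}"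
    then have "x = \<phi> (c (\<phi> 1))"
      using single[of c] by simp
    then show "c = (\<lambda>b. if b = \<phi> 1 then the_inv \<phi> x else 0)"
      using c by (intro ext) auto
  qed
  then have "hamel_basis (real_copy \<phi>) {\<phi> 1}"
    by (simp add: hamel_basis_def)
  then show ?thesis
    unfolding positive_dim_def by blast
qed

end

theorem theorem3p15:
  fixes X :: "'a topology"
  assumes "completely_regular_space X" and "Hausdorff_space X"
    and "(UNIV :: real set) \<lesssim> (UNIV :: 'm set)"
    and "(UNIV :: real set) \<lesssim> (UNIV :: 'l set)"
  shows "(Baire_space (Cp X euclideanreal) \<longleftrightarrow>
           (\<exists>(M :: (real, 'm) module) T.
              frechet_space M T \<and> positive_dim M \<and> Baire_space (Cp X T)))
       \<and> (Baire_space (Cp X euclideanreal) \<longleftrightarrow>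
           (\<forall>(L :: (real, 'l) module) T.
              frechet_space L T \<longrightarrow> Baire_space (Cp X T)))"
proof -
  \<comment> \<open>The copy along \<open>\<phi>\<close> is the witness for \<open>M\<close>; the
    copy along \<open>\<psi>\<close> is the \<open>L\<close> from which the real case is
    recovered.\<close>
  obtain \<phi> :: "real \<Rightarrow> 'm" and \<psi> :: "real \<Rightarrow> 'l" where "inj \<phi>" "inj \<psi>"
    using assms(3,4) by (auto simp: lepoll_def)
  then show ?thesis
    using Baire_Cp_frechet[OF assms(1,2)] Baire_Cp_real
      frechet_space_real_copy[of \<phi>] positive_dim_real_copy[of \<phi>]
      frechet_space_real_copy[of \<psi>] positive_dim_real_copy[of \<psi>]
    by metis
qed

end
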